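(* Let $m\ge n$ be positive integers, let $A_0,A_1,\dots,A_n\in\mathbb{R}^{m\times n}$, and for $\bm{c}=(c_1,\dots,c_n)^T\in\mathbb{R}^n$ put $A(\bm{c})=A_0+\sum_{i=1}^n c_iA_i$. Let $\sigma_1^*>\sigma_2^*>\cdots>\sigma_n^*>0$ be given, and suppose that $\bm{c}^*\in\mathbb{R}^n$ is a solution of the inverse singular value problem, i.e. the singular values of $A(\bm{c}^* )$ in decreasing order are $\sigma_1^*,\dots,\sigma_n^*$. Suppose that the Jacobian matrix $\bm{f}'(\bm{c}^* )\in\mathbb{R}^{n\times n}$, with entries $[\bm{f}'(\bm{c}^* )]_{ij}=\bm{u}_i(\bm{c}^* )^TA_j\bm{v}_i(\bm{c}^* )$, $1\le i,j\le n$, is nonsingular, where $\bm{u}_i(\bm{c}^* ),\bm{v}_i(\bm{c}^* )$ are corresponding unit left and right singular vectors of $A(\bm{c}^* )$ for $\sigma_i^*$. Then there exist positive constants $r$, $\mu$ and $L$ such that, for each $\bm{c}^0\in\mathbb{R}^n$ with $\|\bm{c}^0-\bm{c}^*\|<r$ and each $B_0\in\mathbb{R}^{n\times n}$ satisfying $$\|I-B_0J_0\|\le\mu,$$ the sequence $\{\bm{c}^k\}$ generated by the Cayley-free two-step algorithm (described in the context) started from $\bm{c}^0$ and $B_0$ is well-defined and converges to $\bm{c}^*$ with root-convergence rate at least cubic, i.e. $O_R\{\bm{c}^*\}\ge 3$. Furthermore, for every $k\ge 0$, $$\|\bm{c}^k-\bm{c}^*\|\le Lr\left(\tfrac12\r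ight)^{3^k}.$$
   Context: Notation. $\|\cdot\|$ is the Euclidean vector norm and the induced (spectral) matrix norm; $I$ is an identity matrix of the appropriate size. Index sets: $\mathcal{I}_1=\{(i,j):1\le i,j\le n,\ i\ne j\}$, $\mathcal{I}_2=\{(i,j): n+1\le i\le m,\ 1\le j\le n\}$, $\mathcal{I}_3=\{(i,j):1\le i\le n,\ n+1\le j\le m\}$, $\mathcal{I}_4=\{(i,j): n+1\le i,j\le m,\ i\neq j\}$. Cayley-free two-step algorithm. Input: $\bm{c}^0\in\mathbb{R}^n$, $B_0\in\mathbb{R}^{n\times n}$. Initialization: let $U_0=[\bm{u}_1^0,\dots,\bm{u}_m^0]\in\mathbb{R}^{m\times m}$ and $V_0=[\bm{v}_1^0,\dots,\bm{v}_n^0]\in\mathbb{R}^{n\times n}$ be orthogonal matrices of left and right singular vectors of $A(\bm{c}^0)$ (singular values in decreasing order). For every $k\ge0$, given $U_k=[\bm{u}_1^k,\dots,\bm{u}_m^k]$ and $V_k=[\bm{v}_1^k,\dots,\bm{v}_n^k]$, define $J_k\in\mathbb{R}^{n\times n}$ and $\bm{b}^k\in\mathbb{R}^n$ by $[J_k]_{ij}=(\bm{u}_i^k)^TA_j\bm{v}_i^k$ and $[\bm{b}^k]_i=(\bm{u}_i^k)^TA_0\bm{v}_i^k-\frac{\sigma_i^*}{2}\big((\bm{u}_i^k)^T\bm{u}_i^k+(\bm{v}_i^k)^T\bm{v}_i^k\big)$, $1\le i,j\le n$. For $k=0,1,2,\dots$: (1) $\overline{\bm{c}}^k=\bm{c}^k-B_k(J_k\bm{c}^k+\bm{b}^k)$.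 (2) With $W_k=U_k^TA(\overline{\bm{c}}^k)V_k$, define $\overline{X}_k\in\mathbb{R}^{m\times m}$ and $\overline{Y}_k\in\mathbb{R}^{n\times n}$ by $[\overline{X}_k]_{ii}=\frac{(\bm{u}_i^k)^T\bm{u}_i^k-1}{2}$ ($1\le i\le m$); $[\overline{X}_k]_{ij}=\frac{\sigma_i^*[W_k]_{ji}+\sigma_j^*[W_k]_{ij}-(\sigma_j^* )^2(\bm{u}_i^k)^T\bm{u}_j^k-\sigma_i^*\sigma_j^*(\bm{v}_i^k)^T\bm{v}_j^k}{(\sigma_i^* )^2-(\sigma_j^* )^2}$ ($(i,j)\in\mathcal{I}_1$); $[\overline{X}_k]_{ij}=(\bm{u}_i^k)^T\bm{u}_j^k-\frac{[W_k]_{ij}}{\sigma_j^*}$ ($(i,j)\in\mathcal{I}_2$); $[\overline{X}_k]_{ij}=\frac{[W_k]_{ji}}{\sigma_i^*}$ ($(i,j)\in\mathcal{I}_3$); $[\overline{X}_k]_{ij}=\frac{(\bm{u}_i^k)^T\bm{u}_j^k}{2}$ ($(i,j)\in\mathcal{I}_4$); $[\overline{Y}_k]_{ii}=\frac{(\bm{v}_i^k)^T\bm{v}_i^k-1}{2}$ ($1\le i\le n$); $[\overline{Y}_k]_{ij}=\frac{\sigma_i^*[W_k]_{ij}+\sigma_j^*[W_k]_{ji}-\sigma_i^*\sigma_j^*(\bm{u}_i^k)^T\bm{u}_j^k-(\sigma_j^* )^2(\bm{v}_j^k)^T\bm{v}_i^k}{(\sigma_i^* )^2-(\sigma_j^*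 )^2}$ ($(i,j)\in\mathcal{I}_1$). (3) $\overline{U}_k=[\overline{\bm{u}}_1^k,\dots,\overline{\bm{u}}_m^k]=U_k(I-\overline{X}_k)$ and $\overline{V}_k=[\overline{\bm{v}}_1^k,\dots,\overline{\bm{v}}_n^k]=V_k(I-\overline{Y}_k)$. (4) $[\bm{\rho}^k]_i=(\overline{\bm{u}}_i^k)^TA(\overline{\bm{c}}^k)\overline{\bm{v}}_i^k-\frac{\sigma_i^*}{2}\big((\overline{\bm{u}}_i^k)^T\overline{\bm{u}}_i^k+(\overline{\bm{v}}_i^k)^T\overline{\bm{v}}_i^k\big)$, $1\le i\le n$. (5) $\bm{c}^{k+1}=\overline{\bm{c}}^k-B_k\bm{\rho}^k$. (6) With $\overline{W}_k=\overline{U}_k^TA(\bm{c}^{k+1})\overline{V}_k$, define $\overline{E}_k\in\mathbb{R}^{m\times m}$ and $\overline{F}_k\in\mathbb{R}^{n\times n}$ by exactly the formulas of step (2) for $\overline{X}_k$ and $\overline{Y}_k$ respectively, with $W_k,\bm{u}_i^k,\bm{v}_i^k$ replaced throughout by $\overline{W}_k,\overline{\bm{u}}_i^k,\overline{\bm{v}}_i^k$. (7) $U_{k+1}=\overline{U}_k(I-\overline{E}_k)$, $V_{k+1}=\overline{V}_k(I-\overline{F}_k)$. (8) With $U_{k+1}=[\bm{u}_1^{k+1},\dots,\bm{u}_m^{k+1}]$ and $V_{k+1}=[\bm{v}_1^{k+1},\dots,\bm{v}_n^{k+1}]$, form $J_{k+1}$ and $\bm{b}^{k+1}$ by $[J_{k+1}]_{ij}=(\bm{u}_i^{k+1})^TA_j\bm{v}_i^{k+1}$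 and $[\bm{b}^{k+1}]_i=(\bm{u}_i^{k+1})^TA_0\bm{v}_i^{k+1}-\frac{\sigma_i^*}{2}\big((\bm{u}_i^{k+1})^T\bm{u}_i^{k+1}+(\bm{v}_i^{k+1})^T\bm{v}_i^{k+1}\big)$, $1\le i,j\le n$. (9) $B_{k+1}=B_k+B_k(2I-J_{k+1}B_k)(I-J_{k+1}B_k)$. Root-convergence. For a sequence $\{\bm{x}^k\}$ with limit $\bm{x}^*$, put $R_1\{\bm{x}^k\}=\limsup_{k\to\infty}\|\bm{x}^k-\bm{x}^*\|^{1/k}$ and $R_p\{\bm{x}^k\}=\limsup_{k\to\infty}\|\bm{x}^k-\bm{x}^*\|^{1/p^k}$ for $p>1$. The root-convergence rate is $O_R\{\bm{x}^*\}=\infty$ if $R_p\{\bm{x}^k\}=0$ for all $p\in[1,\infty)$, and $O_R\{\bm{x}^*\}=\inf\{p\in[1,\infty): R_p\{\bm{x}^k\}=1\}$ otherwise. *)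

theory Defs
  imports "HOL-Analysis.Analysis"
begin

text \<open>
  The notation \<^typ>\<open>real^'n^'m\<close> forces the sort \<open>finite\<close> on unconstrained index types;
  the synonyms leave the sorts to be inferred.
\<close>

type_synonym 'n rvec = "(real, 'n) vec"
type_synonym ('m, 'n) rmat = "((real, 'n) vec, 'm) vec"

text \<open>
  An \<open>m \<times> n\<close> matrix has type \<open>('m, 'n) rmat\<close> with \<open>CARD('m) = m\<close> and \<open>CARD('n) = n\<close>.
  The linear orders on the two index types supply the numberings \<open>1..m\<close> and \<open>1..n\<close>.
  \<open>emb\<close> identifies \<open>1..n\<close> with the first \<open>n\<close> elements of \<open>1..m\<close> (it is meaningful only
  if \<open>CARD('n) \<le> CARD('m)\<close>), so \<open>i \<notin> range emb\<close> says \<open>n + 1 \<le> i \<le> m\<close>.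
\<close>

definition emb :: "'n::{finite,linorder} \<Rightarrow> 'm::{finite,linorder}" where
  "emb j = (THE i. card {..<i} = card {..<j})"

lemma card_lessThan_mono:
  fixes i j :: "'a::{finite,linorder}"
  assumes "i < j" shows "card {..<i} < card {..<j}"
  by (rule psubset_card_mono) (use assms in auto)

lemma card_lessThan_inj: "inj (\<lambda>i::'a::{finite,linorder}. card {..<i})"
  by (rule injI) (metis card_lessThan_mono less_irrefl linorder_neqE)

lemma card_lessThan_less: "card {..<(i::'a::{finite,linorder})} < CARD('a)"
  by (rule psubset_card_mono) auto

lemma range_card_lessThan: "range (\<lambda>i::'a::{finite,linorder}. card {..<i}) = {..<CARD('a)}"
proof (rule card_subset_eq)
  show "range (\<lambda>i::'a. card {..<i}) \<subseteq> {..<CARD('a)}"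
    using card_lessThan_less by blast
  show "card (range (\<lambda>i::'a. card {..<i})) = card {..<CARD('a)}"
    by (simp only: card_image[OF card_lessThan_inj] card_lessThan)
qed simp

lemma card_lessThan_emb:
  fixes j :: "'n::{finite,linorder}"
  assumes "CARD('n) \<le> CARD('m)"
  shows "card {..<(emb j :: 'm::{finite,linorder})} = card {..<j}"
proof -
  have "card {..<j} \<in> range (\<lambda>i::'m. card {..<i})"
    using card_lessThan_less[of j] assms by (simp add: range_card_lessThan)
  then obtain i :: 'm where i: "card {..<i} = card {..<j}" by auto
  have "(THE i::'m. card {..<i} = card {..<j}) = i"
    by (rule the_equality) (use i injD[OF card_lessThan_inj] in metis)+
  then show ?thesis using i by (simp add: emb_def)
qed

lemma strict_mono_emb:
  assumes "CARD('n) \<le> CARD('m)"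
  shows "strict_mono (emb :: 'n::{finite,linorder} \<Rightarrow> 'm::{finite,linorder})"
proof (rule strict_monoI)
  fix i j :: 'n assume "i < j"
  then have "card {..<(emb i :: 'm)} < card {..<(emb j :: 'm)}"
    using card_lessThan_mono[of i j] by (simp add: card_lessThan_emb[OF assms])
  then show "emb i < (emb j :: 'm)"
    using card_lessThan_mono by (metis less_asym less_irrefl linorder_neqE)
qed

lemma range_emb:
  assumes "CARD('n) \<le> CARD('m)"
  shows "range (emb :: 'n::{finite,linorder} \<Rightarrow> 'm::{finite,linorder})
           = {i. card {..<i} < CARD('n)}"
proof (intro equalityI subsetI)
  fix i :: 'm assume "i \<in> range (emb :: 'n \<Rightarrow> 'm)"
  then show "i \<in> {i. card {..<i} < CARD('n)}"
    by (auto simp: card_lessThan_emb[OF assms] card_lessThan_less)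
next
  fix i :: 'm assume "i \<in> {i. card {..<i} < CARD('n)}"
  then have "card {..<i} \<in> range (\<lambda>j::'n. card {..<j})"
    by (simp add: range_card_lessThan)
  then obtain j :: 'n where "card {..<i} = card {..<j}" by auto
  then have "emb j = i"
    using card_lessThan_emb[OF assms, of j] injD[OF card_lessThan_inj] by metis
  then show "i \<in> range (emb :: 'n \<Rightarrow> 'm)" by auto
qed

definition affine_mat ::
  "('m::finite, 'n::finite) rmat \<Rightarrow> ('n \<Rightarrow> ('m, 'n) rmat)
     \<Rightarrow> 'n rvec \<Rightarrow> ('m, 'n) rmat" where
  "affine_mat A0 A c = A0 + (\<Sum>i\<in>UNIV. c $ i *\<^sub>R A i)"

text \<open>The spectral norm; \<^const>\<open>norm\<close> on matrices is the Frobenius norm.\<close>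

definition spectral_norm :: "('m::finite, 'n::finite) rmat \<Rightarrow> real" where
  "spectral_norm M = onorm (\<lambda>x. M *v x)"

text \<open>
  \<open>U\<close> and \<open>V\<close> are orthogonal matrices of left and right singular vectors of \<open>M\<close>, and
  \<open>s\<close> lists the singular values of \<open>M\<close>, with multiplicity, in decreasing order.
\<close>

definition is_svd ::
  "('m::{finite,linorder}, 'n::{finite,linorder}) rmat \<Rightarrow> ('m, 'm) rmat
     \<Rightarrow> ('n \<Rightarrow> real) \<Rightarrow> ('n, 'n) rmat \<Rightarrow> bool" where
  "is_svd M U s V \<longleftrightarrow>
     orthogonal_matrix U \<and> orthogonal_matrix V \<and>
     (\<forall>j. 0 \<le> s j) \<and> antimono s \<and>
     transpose U ** M ** V = (\<chi> i j. if i = emb j then s j else 0)"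

definition singular_values ::
  "('m::{finite,linorder}, 'n::{finite,linorder}) rmat \<Rightarrow> ('n \<Rightarrow> real)
     \<Rightarrow> bool" where
  "singular_values M s \<longleftrightarrow> (\<exists>U V. is_svd M U s V)"

definition unit_singular_pair ::
  "('m::finite, 'n::finite) rmat \<Rightarrow> real
     \<Rightarrow> 'm rvec \<Rightarrow> 'n rvec \<Rightarrow> bool" where
  "unit_singular_pair M s u v \<longleftrightarrow>
     norm u = 1 \<and> norm v = 1 \<and> M *v v = s *\<^sub>R u \<and> transpose M *v u = s *\<^sub>R v"

definition jac ::
  "('n::finite \<Rightarrow> ('m::finite, 'n) rmat) \<Rightarrow> ('n \<Rightarrow> 'm rvec)
     \<Rightarrow> ('n \<Rightarrow> 'n rvec) \<Rightarrow> ('n, 'n) rmat" where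
  "jac A u v = (\<chi> i j. u i \<bullet> (A j *v v i))"

text \<open>The matrix \<open>J\<^sub>k\<close>, built from the first \<open>n\<close> columns of \<open>U\<close> and the columns of \<open>V\<close>.\<close>

definition jac_mat ::
  "('n::{finite,linorder} \<Rightarrow> ('m::{finite,linorder}, 'n) rmat) \<Rightarrow> ('m, 'm) rmat
     \<Rightarrow> ('n, 'n) rmat \<Rightarrow> ('n, 'n) rmat" where
  "jac_mat A U V = jac A (\<lambda>i. column (emb i) U) (\<lambda>i. column i V)"

text \<open>This is \<open>b\<^sup>k\<close> for \<open>M = A\<^sub>0\<close>, and \<open>\<rho>\<^sup>k\<close> for \<open>M\<close> the matrix at the intermediate iterate.\<close>

definition resid ::
  "('n::{finite,linorder} \<Rightarrow> real) \<Rightarrow> ('m::{finite,linorder}, 'n) rmat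
     \<Rightarrow> ('m, 'm) rmat \<Rightarrow> ('n, 'n) rmat \<Rightarrow> 'n rvec" where
  "resid \<sigma> M U V =
     (\<chi> i. let u = column (emb i) U; v = column i V
           in u \<bullet> (M *v v) - \<sigma> i / 2 * (u \<bullet> u + v \<bullet> v))"

text \<open>\<open>a\<close> and \<open>b\<close> are \<open>i\<close> and \<open>j\<close> as elements of \<open>'n\<close>; they are used only for indices in \<open>R\<close>.\<close>

definition X_corr ::
  "('n::{finite,linorder} \<Rightarrow> real) \<Rightarrow> ('m::{finite,linorder}, 'n) rmat
     \<Rightarrow> ('m, 'm) rmat \<Rightarrow> ('n, 'n) rmat \<Rightarrow> ('m, 'm) rmat" where
  "X_corr \<sigma> W U V =
     (\<chi> i j.
        let R = range (emb :: 'n \<Rightarrow> 'm);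
            a = inv (emb :: 'n \<Rightarrow> 'm) i;
            b = inv (emb :: 'n \<Rightarrow> 'm) j;
            uu = column i U \<bullet> column j U
        in if i = j then (uu - 1) / 2
           else if i \<in> R \<and> j \<in> R then
             (\<sigma> a * W $ j $ a + \<sigma> b * W $ i $ b - (\<sigma> b)\<^sup>2 * uu
                - \<sigma> a * \<sigma> b * (column a V \<bullet> column b V)) / ((\<sigma> a)\<^sup>2 - (\<sigma> b)\<^sup>2)
           else if i \<notin> R \<and> j \<in> R then uu - W $ i $ b / \<sigma> b
           else if i \<in> R \<and> j \<notin> R then W $ j $ a / \<sigma> a
           else uu / 2)"

definition Y_corr ::
  "('n::{finite,linorder} \<Rightarrow> real) \<Rightarrow> ('m::{finite,linorder}, 'n) rmat
     \<Rightarrow> ('m, 'm) rmat \<Rightarrow> ('n, 'n) rmat \<Rightarrow> ('n, 'n) rmat" where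
  "Y_corr \<sigma> W U V =
     (\<chi> i j.
        if i = j then (column i V \<bullet> column i V - 1) / 2
        else (\<sigma> i * W $ emb i $ j + \<sigma> j * W $ emb j $ i
                - \<sigma> i * \<sigma> j * (column (emb i) U \<bullet> column (emb j) U)
                - (\<sigma> j)\<^sup>2 * (column j V \<bullet> column i V)) / ((\<sigma> i)\<^sup>2 - (\<sigma> j)\<^sup>2))"

text \<open>
  One iteration of the algorithm, on states \<open>(c, U, V, B)\<close>; \<open>J\<^sub>k\<close> and \<open>b\<^sup>k\<close> are
  recomputed from \<open>U\<close> and \<open>V\<close>. In the last line, \<^term>\<open>mat 2\<close> is \<open>2 I\<close>.
\<close>

definition cf_step ::
  "('m::{finite,linorder}, 'n::{finite,linorder}) rmat \<Rightarrow> ('n \<Rightarrow> ('m, 'n) rmat) \<Rightarrow> ('n \<Rightarrow> real)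
     \<Rightarrow> 'n rvec \<times> ('m, 'm) rmat \<times> ('n, 'n) rmat \<times> ('n, 'n) rmat
     \<Rightarrow> 'n rvec \<times> ('m, 'm) rmat \<times> ('n, 'n) rmat \<times> ('n, 'n) rmat" where
  "cf_step A0 A \<sigma> = (\<lambda>(c, U, V, B).
     let c_bar = c - B *v (jac_mat A U V *v c + resid \<sigma> A0 U V);
         W = transpose U ** affine_mat A0 A c_bar ** V;
         U_bar = U ** (mat 1 - X_corr \<sigma> W U V);
         V_bar = V ** (mat 1 - Y_corr \<sigma> W U V);
         \<rho> = resid \<sigma> (affine_mat A0 A c_bar) U_bar V_bar;
         c_new = c_bar - B *v \<rho>;
         W_bar = transpose U_bar ** affine_mat A0 A c_new ** V_bar;
         U_new = U_bar ** (mat 1 - X_corr \<sigma> W_bar U_bar V_bar);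
         V_new = V_bar ** (mat 1 - Y_corr \<sigma> W_bar U_bar V_bar);
         J_new = jac_mat A U_new V_new;
         B_new = B + B ** (mat 2 - J_new ** B) ** (mat 1 - J_new ** B)
     in (c_new, U_new, V_new, B_new))"

definition cf_init ::
  "('m::{finite,linorder}, 'n::{finite,linorder}) rmat \<Rightarrow> ('n \<Rightarrow> ('m, 'n) rmat)
     \<Rightarrow> 'n rvec \<Rightarrow> ('m, 'm) rmat \<Rightarrow> ('n, 'n) rmat \<Rightarrow> bool" where
  "cf_init A0 A c0 U0 V0 \<longleftrightarrow> (\<exists>s. is_svd (affine_mat A0 A c0) U0 s V0)"

definition cf_seq ::
  "('m::{finite,linorder}, 'n::{finite,linorder}) rmat \<Rightarrow> ('n \<Rightarrow> ('m, 'n) rmat) \<Rightarrow> ('n \<Rightarrow> real)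
     \<Rightarrow> 'n rvec \<Rightarrow> ('m, 'm) rmat \<Rightarrow> ('n, 'n) rmat \<Rightarrow> ('n, 'n) rmat \<Rightarrow> nat \<Rightarrow> 'n rvec" where
  "cf_seq A0 A \<sigma> c0 U0 V0 B0 k = fst ((cf_step A0 A \<sigma> ^^ k) (c0, U0, V0, B0))"

text \<open>
  The only partial operations of the algorithm are the choice of the initial singular
  vectors and the divisions in \<^const>\<open>X_corr\<close> and \<^const>\<open>Y_corr\<close>, whose denominators
  depend on \<open>\<sigma>\<close> alone.
\<close>

definition cf_well_defined ::
  "('m::{finite,linorder}, 'n::{finite,linorder}) rmat \<Rightarrow> ('n \<Rightarrow> ('m, 'n) rmat)
     \<Rightarrow> ('n \<Rightarrow> real) \<Rightarrow> 'n rvec \<Rightarrow> bool" where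
  "cf_well_defined A0 A \<sigma> c0 \<longleftrightarrow>
     (\<exists>U0 V0. cf_init A0 A c0 U0 V0) \<and>
     (\<forall>i j. i \<noteq> j \<longrightarrow> (\<sigma> i)\<^sup>2 - (\<sigma> j)\<^sup>2 \<noteq> 0) \<and> (\<forall>i. \<sigma> i \<noteq> 0)"

definition root_factor :: "real \<Rightarrow> (nat \<Rightarrow> 'a::real_normed_vector) \<Rightarrow> 'a \<Rightarrow> ereal" where
  "root_factor p x l =
     limsup (\<lambda>k. ereal (norm (x k - l) powr (1 / (if p = 1 then real k else p ^ k))))"

text \<open>The infimum is taken in \<^typ>\<open>ereal\<close>, so that it is \<open>\<infinity>\<close> for the empty set.\<close>

definition root_rate :: "(nat \<Rightarrow> 'a::real_normed_vector) \<Rightarrow> 'a \<Rightarrow> ereal" where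
  "root_rate x l =
     (if \<forall>p\<ge>1. root_factor p x l = 0 then \<infinity>
      else Inf (ereal ` {p. 1 \<le> p \<and> root_factor p x l = 1}))"

end

theory Submission
  imports Defs "HOL-Library.Landau_Symbols" "HOL-Real_Asymp.Real_Asymp"
begin

text \<open>
  In coordinates given by singular vectors \<open>P\<close>, \<open>Q\<close> of the solution matrix, an iterate is measured by
  \<open>G = P\<^sup>T U\<close> and \<open>H = Q\<^sup>T V\<close>. The error consists of the distance of \<open>c\<close> to the solution, of
  \<open>H\<close> and \<open>B\<close> to \<open>I\<close> and to the inverse Jacobian, of \<open>G\<^sup>T G\<close> to \<open>I\<close>, and of the entries of
  \<open>G\<close> outside the trailing block to those of \<open>I\<close>. The trailing block of \<open>G\<close> need not be near \<open>I\<close>, since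
  the left singular vectors beyond the \<open>n\<close>-th are only determined up to rotation.

  If the error is \<open>e\<close>, then the residual is \<open>J (c - c\<^sup>*) + O(e\<^sup>2)\<close>, so the first correction of \<open>c\<close> leaves
  an error \<open>O(e\<^sup>2)\<close>. The matrices \<open>X\<close> and \<open>Y\<close> cancel the linear part of the errors of \<open>G\<close> and
  \<open>H\<close>, which become \<open>O(e\<^sup>2)\<close> too. The second correction reuses \<open>B\<close> with \<open>I - B J = O(e)\<close> and gains
  one more order, and \<open>I - B J\<close> is cubed by the update of \<open>B\<close>. Hence a step maps the error \<open>e\<close> to
  \<open>O(e\<^sup>3)\<close>. At the start the error is small by compactness of the orthogonal matrices.

  The constants are hidden in Landau symbols over the principal filter of all admissible configurations.
\<close>

section \<open>Matrices and Landau symbols\<close>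

lemma sum_delta_mult:
  fixes f :: "'k::finite \<Rightarrow> 'b::semiring_1"
  shows "(\<Sum>k\<in>UNIV. (if k = a then 1 else 0) * f k) = f a"
    "(\<Sum>k\<in>UNIV. (if a = k then 1 else 0) * f k) = f a"
    "(\<Sum>k\<in>UNIV. f k * (if k = a then 1 else 0)) = f a"
    "(\<Sum>k\<in>UNIV. f k * (if a = k then 1 else 0)) = f a"
  by (simp_all add: if_distrib[of "\<lambda>y. _ * y"] if_distrib[of "\<lambda>y. y * _"] cong: if_cong)

lemma sum_delta_mult':
  fixes f :: "'k::finite \<Rightarrow> 'b::semiring_1"
  shows "(\<Sum>k\<in>UNIV. c k * ((if k = a then 1 else 0) * f k)) = c a * f a"
  using sum_delta_mult(1)[of a "\<lambda>k. c k * f k"]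
  by (simp add: if_distrib[of "\<lambda>y. _ * y"] if_distrib[of "\<lambda>y. y * _"] cong: if_cong)

lemma matrix_add_rdistrib: "(B + C) ** A = B ** A + C ** A"
  for A :: "'b::semiring_1^'n^'m"
  by (simp add: matrix_matrix_mult_def vec_eq_iff distrib_right sum.distrib)

lemma emb_eq_iff:
  assumes "CARD('n) \<le> CARD('m)"
  shows "(emb a :: 'm::{finite,linorder}) = emb b \<longleftrightarrow> a = (b :: 'n::{finite,linorder})"
  using strict_mono_eq[OF strict_mono_emb[OF assms]] .

text \<open>The middle factor of a singular value decomposition; in coordinates given by singular
  vectors it is the matrix at the solution.\<close>

definition rect_diag :: "('n \<Rightarrow> real) \<Rightarrow> ('m::{finite,linorder}, 'n::{finite,linorder}) rmat" where
  "rect_diag \<sigma> = (\<chi> i j. if i = emb j then \<sigma> j else 0)"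

lemma transpose_rect_diag_mult:
  fixes G :: "('m::{finite,linorder}, 'm) rmat" and H :: "('n::{finite,linorder}, 'n) rmat"
  shows "(transpose G ** rect_diag \<sigma> ** H) $ i $ b
     = (\<Sum>l\<in>UNIV. \<sigma> l * G $ emb l $ i * H $ l $ b)"
proof -
  have "(transpose G ** rect_diag \<sigma>) $ i $ l = \<sigma> l * G $ emb l $ i" for l
    by (simp add: rect_diag_def matrix_matrix_mult_def transpose_def
      if_distrib[of "\<lambda>y. _ * y"] cong: if_cong)
  then show ?thesis
    by (simp add: matrix_matrix_mult_def[of "_ ** _"])
qed

lemma gram_entry: "(transpose G ** G) $ i $ j = column i G \<bullet> column j G"
  for G :: "('m::finite, 'k::finite) rmat"
  by (simp add: matrix_mult_transpose_dot_column)

lemma norm_matrix_sqr: "(norm M)\<^sup>2 = trace (M ** transpose M)" for M :: "('m::finite, 'n::finite) rmat"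
  by (simp add: power2_norm_eq_inner inner_vec_def trace_def matrix_matrix_mult_def transpose_def)

text \<open>For symmetric \<open>S\<close> the squared Frobenius norm of \<open>S - I\<close> is
  \<open>tr S^2 - 2 tr S + tr I\<close>, and by cyclicity these traces agree for
  \<open>G G^T\<close> and \<open>G^T G\<close>. This controls \<open>G G^T\<close> although the
  trailing block of \<open>G\<close> is not near the identity.\<close>

lemma norm_gram_defect: "norm (G ** transpose G - mat 1) = norm (transpose G ** G - mat 1)"
  for G :: "('m::finite, 'm) rmat"
proof -
  have a: "(norm (S - mat 1))\<^sup>2 = trace (S ** S) - 2 * trace S + trace (mat 1 :: ('m,'m) rmat)"
    if "transpose S = S" for S :: "('m,'m) rmat"
  proof -
    have "(S - mat 1) ** transpose (S - mat 1) = S ** S - S - S + mat 1"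
      using that by (simp add: transpose_def matrix_matrix_mult_def vec_eq_iff mat_def
        algebra_simps sum.distrib sum_subtractf sum_delta_mult eq_commute)
    then show ?thesis
      by (simp only: norm_matrix_sqr trace_add trace_sub)
  qed
  have "trace (G ** transpose G ** (G ** transpose G)) = trace (transpose G ** G ** (transpose G ** G))"
    by (metis matrix_mul_assoc trace_mul_sym)
  moreover have "trace (G ** transpose G) = trace (transpose G ** G)"
    by (rule trace_mul_sym)
  ultimately have "(norm (G ** transpose G - mat 1))\<^sup>2 = (norm (transpose G ** G - mat 1))\<^sup>2"
    by (simp add: a matrix_transpose_mul)
  then show ?thesis by simp
qed

lemma matrix_entry_le_norm: "\<bar>M $ i $ j\<bar> \<le> norm M" for M :: "('m::finite, 'n::finite) rmat"
  using component_le_norm_cart[of "M $ i" j] Finite_Cartesian_Product.norm_nth_le[of M i] by simp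

lemma norm_le_sum_entries: "norm M \<le> (\<Sum>i\<in>UNIV. \<Sum>j\<in>UNIV. \<bar>M $ i $ j\<bar>)"
  for M :: "('m::finite, 'n::finite) rmat"
proof -
  have "norm M \<le> (\<Sum>i\<in>UNIV. norm (M $ i))"
    unfolding norm_vec_def by (rule L2_set_le_sum) simp
  also have "\<dots> \<le> (\<Sum>i\<in>UNIV. \<Sum>j\<in>UNIV. \<bar>M $ i $ j\<bar>)"
    by (intro sum_mono norm_le_l1_cart)
  finally show ?thesis .
qed

text \<open>\<open>e\<close> measures the errors before a half-step and \<open>q\<close> those
  allowed after it, so products of two errors are negligible. Keeping \<open>q\<close> apart from
  \<open>e^2\<close> lets the same estimates run at several pairs of orders.\<close>

locale gauge =
  fixes F :: "'a filter" and e q :: "'a \<Rightarrow> real"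
  assumes gauge_bounded: "e \<in> O[F](\<lambda>_. 1)"
    and gauge_square: "(\<lambda>x. e x * e x) \<in> O[F](q)"
    and gauge_le: "q \<in> O[F](e)"
begin

lemma q_imp_e: "f \<in> O[F](q) \<Longrightarrow> f \<in> O[F](e)"
  by (rule landau_o.big_trans[OF _ gauge_le])

lemma e_imp_1: "f \<in> O[F](e) \<Longrightarrow> f \<in> O[F](\<lambda>_. 1)"
  by (rule landau_o.big_trans[OF _ gauge_bounded])

lemma mult_ee: "f \<in> O[F](e) \<Longrightarrow> g \<in> O[F](e) \<Longrightarrow> (\<lambda>x. f x * g x) \<in> O[F](q)"
  by (rule landau_o.big_trans[OF landau_o.big.mult gauge_square])

lemma near_const_bounded:
  assumes "(\<lambda>x. f x - c) \<in> O[F](e)" shows "f \<in> O[F](\<lambda>_. 1)"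
  using sum_in_bigo(1)[OF e_imp_1[OF assms] bigo_const[of c F]] by simp

text \<open>The difference is the sum of \<open>s l * (p - p0) * (r - r0)\<close>, in which two
  small factors meet. The expansions of \<open>W\<close> and of the Gram matrices below are
  instances, with Kronecker deltas or zero as base values.\<close>

lemma bilinear_linearization:
  fixes p r :: "'k::finite \<Rightarrow> 'a \<Rightarrow> real"
  assumes "\<And>l. (\<lambda>x. p l x - p0 l) \<in> O[F](e)" and "\<And>l. (\<lambda>x. r l x - r0 l) \<in> O[F](e)"
  shows "(\<lambda>x. (\<Sum>l\<in>UNIV. s l * p l x * r l x)
      - (\<Sum>l\<in>UNIV. s l * (p0 l * r l x + p l x * r0 l - p0 l * r0 l))) \<in> O[F](q)"
proof -
  have "(\<lambda>x. \<Sum>l\<in>UNIV. s l * ((p l x - p0 l) * (r l x - r0 l))) \<in> O[F](q)"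
  proof (intro big_sum_in_bigo)
    fix l
    show "(\<lambda>x. s l * ((p l x - p0 l) * (r l x - r0 l))) \<in> O[F](q)"
      using mult_ee[OF assms] by (cases "s l = 0") simp_all
  qed
  then show ?thesis
    by (simp add: sum_subtractf[symmetric] algebra_simps)
qed

end

lemma bigo_mult1:
  fixes f g :: "'a \<Rightarrow> real"
  shows "f \<in> O[F](k) \<Longrightarrow> g \<in> O[F](\<lambda>_. 1) \<Longrightarrow> (\<lambda>x. f x * g x) \<in> O[F](k)"
    "f \<in> O[F](\<lambda>_. 1) \<Longrightarrow> g \<in> O[F](k) \<Longrightarrow> (\<lambda>x. f x * g x) \<in> O[F](k)"
  using landau_o.big.mult[of f F k g "\<lambda>_. 1"] landau_o.big.mult[of f F "\<lambda>_. 1" g k] by simp_all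

lemma bigo_matrix_mult:
  fixes M :: "'a \<Rightarrow> ('m::finite, 'k::finite) rmat" and N :: "'a \<Rightarrow> ('k, 'n::finite) rmat"
  assumes "\<And>i j. (\<lambda>x. M x $ i $ j) \<in> O[F](f)" and "\<And>i j. (\<lambda>x. N x $ i $ j) \<in> O[F](g)"
    and "(\<lambda>x. f x * g x) \<in> O[F](h)"
  shows "(\<lambda>x. (M x ** N x) $ i $ j) \<in> O[F](h)"
  unfolding matrix_matrix_mult_def
  by (simp, intro big_sum_in_bigo landau_o.big_trans[OF landau_o.big.mult[OF assms(1,2)] assms(3)])

section \<open>A half-step of the refinement\<close>

text \<open>\<open>rect_diag \<sigma> + E\<close> is the matrix at the corrected parameter, in
  coordinates of singular vectors at the solution. The trailing block of \<open>G\<close> is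
  constrained by \<open>G_gram\<close> alone.\<close>

locale half_step = gauge F e q
  for F :: "'a filter" and e q :: "'a \<Rightarrow> real" +
  fixes \<sigma> :: "'n::{finite,linorder} \<Rightarrow> real"
    and G :: "'a \<Rightarrow> ('m::{finite,linorder}, 'm) rmat"
    and H :: "'a \<Rightarrow> ('n, 'n) rmat"
    and E :: "'a \<Rightarrow> ('m, 'n) rmat"
  assumes card_le: "CARD('n) \<le> CARD('m)"
    and sigma_distinct: "\<And>a b. a \<noteq> b \<Longrightarrow> (\<sigma> a)\<^sup>2 - (\<sigma> b)\<^sup>2 \<noteq> 0"
    and sigma_nonzero: "\<And>a. \<sigma> a \<noteq> 0"
    and G_near: "\<And>i j. i \<in> range (emb :: 'n \<Rightarrow> 'm) \<or> j \<in> range (emb :: 'n \<Rightarrow> 'm) \<Longrightarrow>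
      (\<lambda>x. G x $ i $ j - (if i = j then 1 else 0)) \<in> O[F](e)"
    and G_gram: "\<And>i j. (\<lambda>x. (transpose (G x) ** G x) $ i $ j - (if i = j then 1 else 0)) \<in> O[F](e)"
    and H_near: "\<And>i j. (\<lambda>x. H x $ i $ j - (if i = j then 1 else 0)) \<in> O[F](e)"
    and E_small: "\<And>i j. (\<lambda>x. E x $ i $ j) \<in> O[F](q)"
begin

definition "W x = transpose (G x) ** (rect_diag \<sigma> + E x) ** H x"
definition "X x = X_corr \<sigma> (W x) (G x) (H x)"
definition "Y x = Y_corr \<sigma> (W x) (G x) (H x)"

lemma emb_iff [simp]: "(emb a :: 'm) = emb b \<longleftrightarrow> a = (b :: 'n)"
  by (rule emb_eq_iff[OF card_le])

lemma inj_emb: "inj (emb :: 'n \<Rightarrow> 'm)"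
  by (rule injI) simp

lemma H_bounded: "(\<lambda>x. H x $ i $ j) \<in> O[F](\<lambda>_. 1)"
  by (rule near_const_bounded[OF H_near])

lemma G_bounded: "(\<lambda>x. G x $ i $ j) \<in> O[F](\<lambda>_. 1)"
proof -
  have "\<bar>G x $ i $ j\<bar> \<le> 1 + (transpose (G x) ** G x) $ j $ j" for x
  proof -
    have "(G x $ i $ j)\<^sup>2 \<le> (\<Sum>k\<in>UNIV. (G x $ k $ j)\<^sup>2)"
      by (rule member_le_sum) auto
    also have "\<dots> = (transpose (G x) ** G x) $ j $ j"
      by (simp add: matrix_matrix_mult_def transpose_def power2_eq_square)
    finally have "\<bar>G x $ i $ j\<bar>\<^sup>2 \<le> (transpose (G x) ** G x) $ j $ j" by simp
    moreover have "\<bar>G x $ i $ j\<bar> \<le> 1 + \<bar>G x $ i $ j\<bar>\<^sup>2"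
    proof -
      have "0 \<le> (\<bar>G x $ i $ j\<bar> - 1/2)\<^sup>2" by simp
      also have "\<dots> = \<bar>G x $ i $ j\<bar>\<^sup>2 - \<bar>G x $ i $ j\<bar> + 1/4"
        by (simp only: power2_eq_square) (simp add: algebra_simps)
      finally show ?thesis by linarith
    qed
    ultimately show ?thesis by linarith
  qed
  moreover have "(\<lambda>x. 1 + (transpose (G x) ** G x) $ j $ j) \<in> O[F](\<lambda>_. 1)"
    using near_const_bounded[OF G_gram[of j j]] by (intro sum_in_bigo) simp_all
  ultimately show ?thesis
    by (elim landau_o.big_trans[rotated], intro landau_o.big_mono always_eventually allI)
       (simp add: order.trans[OF _ abs_ge_self])
qed

section \<open>First-order expansions of \<open>W\<close>, the Gram matrices, \<open>X\<close> and
  \<open>Y\<close>\<close>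

lemma W_bilinear:
  "(\<lambda>x. W x $ i $ b - (\<Sum>l\<in>UNIV. \<sigma> l * G x $ emb l $ i * H x $ l $ b)) \<in> O[F](q)"
proof -
  have T: "(\<lambda>x. transpose (G x) $ i $ j) \<in> O[F](\<lambda>_. 1)" for i j
    using G_bounded by (simp add: transpose_def)
  have "(\<lambda>x. (transpose (G x) ** E x ** H x) $ i $ b) \<in> O[F](q)"
    by (rule bigo_matrix_mult[OF bigo_matrix_mult[OF T E_small] H_bounded, of q]) simp_all
  moreover have "W x = transpose (G x) ** rect_diag \<sigma> ** H x + transpose (G x) ** E x ** H x" for x
    by (simp add: W_def matrix_add_ldistrib matrix_add_rdistrib)
  ultimately show ?thesis by (simp add: transpose_rect_diag_mult)
qed

lemma G_near_emb:
  "(\<lambda>x. G x $ emb (l :: 'n) $ emb a - (if l = a then 1 else 0)) \<in> O[F](e)"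
  using G_near[of "emb l" "emb a"] by simp

lemma G_near_emb_off:
  "i \<notin> range (emb :: 'n \<Rightarrow> 'm) \<Longrightarrow> (\<lambda>x. G x $ emb (l :: 'n) $ i - 0) \<in> O[F](e)"
  using G_near[of "emb l" i] by (cases "emb l = i") auto

text \<open>In the linearization at \<open>G = I\<close>, \<open>H = I\<close> only the summands
  \<open>l = a\<close> and \<open>l = b\<close> survive; the constant term vanishes because
  \<open>a \<noteq> b\<close>.\<close>

lemma W_near_R:
  assumes "a \<noteq> b"
  shows "(\<lambda>x. W x $ emb a $ b - (\<sigma> a * H x $ a $ b + \<sigma> b * G x $ emb b $ emb a)) \<in> O[F](q)"
proof -
  have "(\<lambda>x. (\<Sum>l\<in>UNIV. \<sigma> l * G x $ emb l $ emb a * H x $ l $ b)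
      - (\<Sum>l\<in>UNIV. \<sigma> l * ((if l = a then 1 else 0) * H x $ l $ b
          + G x $ emb l $ emb a * (if l = b then 1 else 0)
          - (if l = a then 1 else 0) * (if l = b then 1 else 0)))) \<in> O[F](q)"
    by (intro bilinear_linearization G_near_emb H_near)
  from sum_in_bigo(1)[OF W_bilinear[of "emb a" b] this] show ?thesis
    using assms by (simp add: algebra_simps sum.distrib sum_subtractf sum_delta_mult sum_delta_mult'
      if_distrib[of "\<lambda>y. _ * y"] cong: if_cong)
qed

lemma W_near_N:
  assumes "i \<notin> range (emb :: 'n \<Rightarrow> 'm)"
  shows "(\<lambda>x. W x $ i $ b - \<sigma> b * G x $ emb b $ i) \<in> O[F](q)"
proof -
  have "(\<lambda>x. (\<Sum>l\<in>UNIV. \<sigma> l * G x $ emb l $ i * H x $ l $ b)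
      - (\<Sum>l\<in>UNIV. \<sigma> l * (0 * H x $ l $ b
          + G x $ emb l $ i * (if l = b then 1 else 0)
          - 0 * (if l = b then 1 else 0)))) \<in> O[F](q)"
    by (intro bilinear_linearization G_near_emb_off[OF assms] H_near)
  from sum_in_bigo(1)[OF W_bilinear[of i b] this] show ?thesis
    by (simp add: algebra_simps sum.distrib sum_subtractf sum_delta_mult sum_delta_mult'
      if_distrib[of "\<lambda>y. _ * y"] cong: if_cong)
qed

text \<open>Both columns are leading ones, hence near unit vectors in every row. Trailing columns do
  not have this property, so the later expansions involving them keep the Gram entry itself.\<close>

lemma gram_near:
  assumes "i \<in> range (emb :: 'n \<Rightarrow> 'm)" "j \<in> range (emb :: 'n \<Rightarrow> 'm)"
  shows "(\<lambda>x. (transpose (G x) ** G x) $ i $ j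
    - (G x $ i $ j + G x $ j $ i - (if i = j then 1 else 0))) \<in> O[F](q)"
proof -
  have "(\<lambda>x. (\<Sum>l\<in>UNIV. 1 * G x $ l $ i * G x $ l $ j)
      - (\<Sum>l\<in>UNIV. 1 * ((if l = i then 1 else 0) * G x $ l $ j
          + G x $ l $ i * (if l = j then 1 else 0)
          - (if l = i then 1 else 0) * (if l = j then 1 else 0)))) \<in> O[F](q)"
    using assms by (intro bilinear_linearization G_near) auto
  then show ?thesis
    by (simp add: matrix_matrix_mult_def transpose_def sum.distrib sum_subtractf
      sum_delta_mult eq_commute[of j i])
qed

lemma gram_near_H:
  "(\<lambda>x. (transpose (H x) ** H x) $ i $ j
    - (H x $ i $ j + H x $ j $ i - (if i = j then 1 else 0))) \<in> O[F](q)"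
proof -
  have "(\<lambda>x. (\<Sum>l\<in>UNIV. 1 * H x $ l $ i * H x $ l $ j)
      - (\<Sum>l\<in>UNIV. 1 * ((if l = i then 1 else 0) * H x $ l $ j
          + H x $ l $ i * (if l = j then 1 else 0)
          - (if l = i then 1 else 0) * (if l = j then 1 else 0)))) \<in> O[F](q)"
    by (intro bilinear_linearization H_near)
  then show ?thesis
    by (simp add: matrix_matrix_mult_def transpose_def sum.distrib sum_subtractf
      sum_delta_mult eq_commute[of j i])
qed

text \<open>On the diagonal this is the expansion of the Gram entry. Off the diagonal, inserting the
  expansions of \<open>W\<close> and of both Gram matrices into the formula for \<open>X\<close>
  cancels all terms in \<open>H\<close> and in \<open>G $ emb b $ emb a\<close>, and the numerator
  becomes \<open>((\<sigma> a)^2 - (\<sigma> b)^2) * G $ emb a $ emb b\<close>.\<close>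

lemma X_near_RR:
  "(\<lambda>x. X x $ emb (a :: 'n) $ emb b - (G x $ emb a $ emb b - (if a = b then 1 else 0))) \<in> O[F](q)"
proof (cases "a = b")
  case True
  have "(\<lambda>x. ((transpose (G x) ** G x) $ emb a $ emb a - (2 * G x $ emb a $ emb a - 1)) / 2) \<in> O[F](q)"
    using gram_near[of "emb a" "emb a"] by simp
  moreover have eq: "X x $ emb a $ emb a - (G x $ emb a $ emb a - 1)
      = ((transpose (G x) ** G x) $ emb a $ emb a - (2 * G x $ emb a $ emb a - 1)) / 2" for x
    by (simp add: X_def X_corr_def gram_entry field_simps)
  ultimately show ?thesis
    by (simp only: True[symmetric] eq if_True simp_thms)
next
  case False
  let ?w1 = "\<lambda>x. W x $ emb b $ a - (\<sigma> b * H x $ b $ a + \<sigma> a * G x $ emb a $ emb b)"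
  let ?w2 = "\<lambda>x. W x $ emb a $ b - (\<sigma> a * H x $ a $ b + \<sigma> b * G x $ emb b $ emb a)"
  let ?g = "\<lambda>x. (transpose (G x) ** G x) $ emb a $ emb b - (G x $ emb a $ emb b + G x $ emb b $ emb a)"
  let ?h = "\<lambda>x. (transpose (H x) ** H x) $ a $ b - (H x $ a $ b + H x $ b $ a)"
  have "?g \<in> O[F](q)" "?h \<in> O[F](q)"
    using gram_near[of "emb a" "emb b"] gram_near_H[of a b] False by simp_all
  moreover have "?w1 \<in> O[F](q)" "?w2 \<in> O[F](q)"
    using False W_near_R[of b a] W_near_R[of a b] by auto
  ultimately have "(\<lambda>x. (\<sigma> a * ?w1 x + \<sigma> b * ?w2 x - (\<sigma> b)\<^sup>2 * ?g x - \<sigma> a * \<sigma> b * ?h x) / ((\<sigma> a)\<^sup>2 - (\<sigma> b)\<^sup>2))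
      \<in> O[F](q)"
    using sigma_distinct[OF False] sigma_nonzero
    by (simp only: landau_o.big.cdiv_in_iff' not_False_eq_True)
       (intro sum_in_bigo; simp)
  moreover have "X x $ emb a $ emb b - G x $ emb a $ emb b
      = (\<sigma> a * ?w1 x + \<sigma> b * ?w2 x - (\<sigma> b)\<^sup>2 * ?g x - \<sigma> a * \<sigma> b * ?h x) / ((\<sigma> a)\<^sup>2 - (\<sigma> b)\<^sup>2)" for x
    using False sigma_distinct[OF False]
    by (simp add: X_def X_corr_def gram_entry inj_emb inv_f_f field_simps) (simp add: algebra_simps power2_eq_square)
  ultimately show ?thesis using False by simp
qed

lemma X_near_RN:
  assumes "j \<notin> range (emb :: 'n \<Rightarrow> 'm)"
  shows "(\<lambda>x. X x $ emb (a :: 'n) $ j - G x $ emb a $ j) \<in> O[F](q)"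
proof -
  have "emb a \<noteq> j" using assms by auto
  then have "X x $ emb a $ j - G x $ emb a $ j = (W x $ j $ a - \<sigma> a * G x $ emb a $ j) / \<sigma> a" for x
    using assms sigma_nonzero by (simp add: X_def X_corr_def inj_emb inv_f_f field_simps)
  then show ?thesis using W_near_N[OF assms, of a] sigma_nonzero[of a] by simp
qed

lemma X_near_NR:
  assumes "i \<notin> range (emb :: 'n \<Rightarrow> 'm)"
  shows "(\<lambda>x. X x $ i $ emb (b :: 'n) - ((transpose (G x) ** G x) $ i $ emb b - G x $ emb b $ i)) \<in> O[F](q)"
proof -
  have "emb b \<noteq> i" using assms by auto
  then have "X x $ i $ emb b - ((transpose (G x) ** G x) $ i $ emb b - G x $ emb b $ i)
      = - ((W x $ i $ b - \<sigma> b * G x $ emb b $ i) / \<sigma> b)" for x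
    using assms sigma_nonzero
    by (auto simp add: X_def X_corr_def gram_entry inj_emb inv_f_f field_simps)
  then show ?thesis using W_near_N[OF assms, of b] sigma_nonzero[of b] by simp
qed

lemma X_NN:
  assumes "i \<notin> range (emb :: 'n \<Rightarrow> 'm)" "j \<notin> range (emb :: 'n \<Rightarrow> 'm)"
  shows "X x $ i $ j = ((transpose (G x) ** G x) $ i $ j - (if i = j then 1 else 0)) / 2"
  using assms by (simp add: X_def X_corr_def gram_entry)

text \<open>The cancellation is the one for \<open>X\<close> with the roles of \<open>G\<close> and
  \<open>H\<close> exchanged: the numerator reduces to
  \<open>((\<sigma> a)^2 - (\<sigma> b)^2) * H $ a $ b\<close>.\<close>

lemma Y_near:
  "(\<lambda>x. Y x $ a $ b - (H x $ a $ b - (if a = b then 1 else 0))) \<in> O[F](q)"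
proof (cases "a = b")
  case True
  have "(\<lambda>x. ((transpose (H x) ** H x) $ a $ a - (2 * H x $ a $ a - 1)) / 2) \<in> O[F](q)"
    using gram_near_H[of a a] by simp
  moreover have eq: "Y x $ a $ a - (H x $ a $ a - 1)
      = ((transpose (H x) ** H x) $ a $ a - (2 * H x $ a $ a - 1)) / 2" for x
    by (simp add: Y_def Y_corr_def gram_entry field_simps)
  ultimately show ?thesis
    by (simp only: True[symmetric] eq if_True simp_thms)
next
  case False
  let ?w1 = "\<lambda>x. W x $ emb b $ a - (\<sigma> b * H x $ b $ a + \<sigma> a * G x $ emb a $ emb b)"
  let ?w2 = "\<lambda>x. W x $ emb a $ b - (\<sigma> a * H x $ a $ b + \<sigma> b * G x $ emb b $ emb a)"
  let ?g = "\<lambda>x. (transpose (G x) ** G x) $ emb a $ emb b - (G x $ emb a $ emb b + G x $ emb b $ emb a)"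
  let ?h = "\<lambda>x. (transpose (H x) ** H x) $ b $ a - (H x $ b $ a + H x $ a $ b)"
  have "?g \<in> O[F](q)" "?h \<in> O[F](q)"
    using gram_near[of "emb a" "emb b"] gram_near_H[of b a] False by auto
  moreover have "?w1 \<in> O[F](q)" "?w2 \<in> O[F](q)"
    using False W_near_R[of b a] W_near_R[of a b] by auto
  ultimately have "(\<lambda>x. (\<sigma> a * ?w2 x + \<sigma> b * ?w1 x - \<sigma> a * \<sigma> b * ?g x - (\<sigma> b)\<^sup>2 * ?h x) / ((\<sigma> a)\<^sup>2 - (\<sigma> b)\<^sup>2))
      \<in> O[F](q)"
    using sigma_distinct[OF False] sigma_nonzero
    by (simp only: landau_o.big.cdiv_in_iff' not_False_eq_True)
       (intro sum_in_bigo; simp)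
  moreover have "Y x $ a $ b - H x $ a $ b
      = (\<sigma> a * ?w2 x + \<sigma> b * ?w1 x - \<sigma> a * \<sigma> b * ?g x - (\<sigma> b)\<^sup>2 * ?h x) / ((\<sigma> a)\<^sup>2 - (\<sigma> b)\<^sup>2)" for x
    using False sigma_distinct[OF False]
    by (simp add: Y_def Y_corr_def gram_entry field_simps) (simp add: algebra_simps power2_eq_square)
  ultimately show ?thesis using False by simp
qed

end

section \<open>Errors after a half-step, the residual and the Jacobian\<close>

lemma matrix_diff_ldistrib: "A ** (B - C) = A ** B - A ** C"
  for A :: "'b::ring_1^'n^'m"
  by (simp add: matrix_matrix_mult_def vec_eq_iff right_diff_distrib sum_subtractf)

lemma matrix_diff_rdistrib: "(B - C) ** A = B ** A - C ** A"
  for A :: "'b::ring_1^'n^'m"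
  by (simp add: matrix_matrix_mult_def vec_eq_iff left_diff_distrib sum_subtractf)

lemma transpose_diff: "transpose (A - B) = transpose A - transpose B"
  by (simp add: transpose_def vec_eq_iff)

text \<open>The residual is affine in its matrix argument. Hence \<open>J c + b\<close> in the first
  correction is the residual at the current parameter, and both corrections of the parameter have
  the same form.\<close>

lemma resid_affine_mat:
  "resid \<sigma> (affine_mat A0 A c) U V = jac_mat A U V *v c + resid \<sigma> A0 U V"
proof -
  have "affine_mat A0 A c *v w = A0 *v w + (\<Sum>j\<in>UNIV. c $ j *\<^sub>R (A j *v w))" for w
  proof -
    have "(\<Sum>j\<in>S. c $ j *\<^sub>R A j) *v w = (\<Sum>j\<in>S. c $ j *\<^sub>R (A j *v w))" if "finite S" for S
      using that by (induction S) (simp_all add: matrix_vector_mult_add_rdistrib scaleR_matrix_vector_assoc)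
    then show ?thesis
      by (simp add: affine_mat_def matrix_vector_mult_add_rdistrib)
  qed
  then show ?thesis
    by (intro vec_eq_iff[THEN iffD2] allI) (simp add: resid_def jac_mat_def jac_def Let_def
      matrix_vector_mult_def[of "\<chi> i j. _ i j"] inner_add_right inner_sum_right mult.commute)
qed

lemma column_inner_mult: "column i U \<bullet> (M *v column j V) = (transpose U ** M ** V) $ i $ j"
  for M :: "('m::finite, 'n::finite) rmat"
proof -
  have "column i U \<bullet> (M *v column j V) = (\<Sum>k\<in>UNIV. \<Sum>l\<in>UNIV. U $ k $ i * M $ k $ l * V $ l $ j)"
    by (simp add: inner_vec_def column_def matrix_vector_mult_def sum_distrib_left mult.assoc)
  also have "\<dots> = (transpose U ** M ** V) $ i $ j"
    by (subst sum.swap) (simp add: matrix_matrix_mult_def transpose_def sum_distrib_right)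
  finally show ?thesis .
qed

lemma jac_mat_entry: "jac_mat A U V $ a $ b = (transpose U ** A b ** V) $ emb a $ a"
  by (simp add: jac_mat_def jac_def column_inner_mult)

lemma resid_entry:
  "resid \<sigma> M U V $ a = (transpose U ** M ** V) $ emb a $ a
    - \<sigma> a / 2 * ((transpose U ** U) $ emb a $ emb a + (transpose V ** V) $ a $ a)"
  by (simp add: resid_def Let_def column_inner_mult gram_entry)

context half_step
begin

abbreviation "D x \<equiv> transpose (G x) ** G x - mat 1"

lemma D_small: "(\<lambda>x. D x $ i $ j) \<in> O[F](e)"
  using G_gram[of i j] by (simp add: mat_def)

lemma dual_gram_small: "(\<lambda>x. (G x ** transpose (G x) - mat 1) $ i $ j) \<in> O[F](e)"
proof -
  have "(\<lambda>x. \<Sum>i\<in>UNIV. \<Sum>j\<in>UNIV. \<bar>D x $ i $ j\<bar>) \<in> O[F](e)"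
    by (intro big_sum_in_bigo) (simp only: landau_o.big.abs_in_iff D_small)
  moreover have "\<bar>(G x ** transpose (G x) - mat 1) $ i $ j\<bar> \<le> (\<Sum>i\<in>UNIV. \<Sum>j\<in>UNIV. \<bar>D x $ i $ j\<bar>)" for x
    using matrix_entry_le_norm[of "G x ** transpose (G x) - mat 1" i j] norm_le_sum_entries[of "D x"]
    by (simp only: norm_gram_defect)
  ultimately show ?thesis
    by (elim landau_o.big_trans[rotated], intro landau_o.big_mono always_eventually allI)
       (simp only: real_norm_def order.trans[OF _ abs_ge_self])
qed

lemma X_near_R_row:
  assumes "i \<in> range (emb :: 'n \<Rightarrow> 'm)"
  shows "(\<lambda>x. X x $ i $ j - (G x $ i $ j - (if i = j then 1 else 0))) \<in> O[F](q)"
proof (cases "j \<in> range (emb :: 'n \<Rightarrow> 'm)")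
  case True
  with assms obtain a b :: 'n where ab: "i = emb a" "j = emb b" by auto
  show ?thesis using X_near_RR[of a b] unfolding ab by simp
next
  case False
  then show ?thesis using assms X_near_RN[OF False] by auto
qed

lemma X_small: "(\<lambda>x. X x $ i $ j) \<in> O[F](e)"
proof (cases "i \<in> range (emb :: 'n \<Rightarrow> 'm)")
  case True
  then show ?thesis
    using sum_in_bigo(1)[OF q_imp_e[OF X_near_R_row[OF True, of j]] G_near[of i j]] by simp
next
  case i: False
  show ?thesis
  proof (cases "j \<in> range (emb :: 'n \<Rightarrow> 'm)")
    case True
    then obtain b :: 'n where b: "j = emb b" by auto
    have "(\<lambda>x. D x $ i $ j - G x $ j $ i) \<in> O[F](e)"
      using sum_in_bigo(2)[OF D_small G_near_emb_off[OF i, of b]] by (simp only: b diff_0_right)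
    moreover have "D x $ i $ j = (transpose (G x) ** G x) $ i $ j" for x
      using True i by (auto simp: mat_def)
    ultimately have "(\<lambda>x. (transpose (G x) ** G x) $ i $ j - G x $ j $ i) \<in> O[F](e)"
      by simp
    from sum_in_bigo(1)[OF q_imp_e[OF X_near_NR[OF i, of b]] this[unfolded b]] show ?thesis
      by (simp add: b)
  next
    case False
    then show ?thesis
      using G_gram[of i j] by (simp add: X_NN[OF i False])
  qed
qed

text \<open>This makes \<open>(I - X)^T G^T G (I - X)\<close> equal to \<open>I\<close> up to order
  \<open>q\<close>. It comes from the expansion of the Gram entry in the leading block, from the sum
  of the two mixed formulas, and holds exactly in the trailing block.\<close>

lemma X_symmetric_part: "(\<lambda>x. X x $ i $ j + X x $ j $ i - D x $ i $ j) \<in> O[F](q)"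
proof -
  have sym: "D x $ i $ j = D x $ j $ i" for i j x
    by (simp add: gram_entry mat_def inner_commute eq_commute)
  have RR: "(\<lambda>x. X x $ i $ j + X x $ j $ i - D x $ i $ j) \<in> O[F](q)"
    if "i \<in> range (emb :: 'n \<Rightarrow> 'm)" "j \<in> range (emb :: 'n \<Rightarrow> 'm)" for i j
  proof -
    from that have "(\<lambda>x. (X x $ i $ j - (G x $ i $ j - (if i = j then 1 else 0)))
        + (X x $ j $ i - (G x $ j $ i - (if j = i then 1 else 0)))
        - ((transpose (G x) ** G x) $ i $ j
          - (G x $ i $ j + G x $ j $ i - (if i = j then 1 else 0)))) \<in> O[F](q)"
      by (intro sum_in_bigo X_near_R_row gram_near)
    moreover have "(X x $ i $ j - (G x $ i $ j - (if i = j then 1 else 0)))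
        + (X x $ j $ i - (G x $ j $ i - (if j = i then 1 else 0)))
        - ((transpose (G x) ** G x) $ i $ j
          - (G x $ i $ j + G x $ j $ i - (if i = j then 1 else 0)))
        = X x $ i $ j + X x $ j $ i - D x $ i $ j" for x
      by (simp add: mat_def)
    ultimately show ?thesis by simp
  qed
  have NR: "(\<lambda>x. X x $ i $ j + X x $ j $ i - D x $ i $ j) \<in> O[F](q)"
    if i: "i \<notin> range (emb :: 'n \<Rightarrow> 'm)" and j: "j \<in> range (emb :: 'n \<Rightarrow> 'm)" for i j
  proof -
    obtain b :: 'n where b: "j = emb b" using j by auto
    have ne: "i \<noteq> j" using i j by auto
    have "(\<lambda>x. (X x $ i $ j - ((transpose (G x) ** G x) $ i $ j - G x $ j $ i))
        + (X x $ j $ i - G x $ j $ i)) \<in> O[F](q)"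
      unfolding b by (intro sum_in_bigo X_near_NR X_near_RN i)
    moreover have "(X x $ i $ j - ((transpose (G x) ** G x) $ i $ j - G x $ j $ i))
        + (X x $ j $ i - G x $ j $ i) = X x $ i $ j + X x $ j $ i - D x $ i $ j" for x
      using ne by (simp add: mat_def)
    ultimately show ?thesis by simp
  qed
  have NN: "(\<lambda>x. X x $ i $ j + X x $ j $ i - D x $ i $ j) \<in> O[F](q)"
    if "i \<notin> range (emb :: 'n \<Rightarrow> 'm)" "j \<notin> range (emb :: 'n \<Rightarrow> 'm)" for i j
  proof -
    have "X x $ i $ j + X x $ j $ i - D x $ i $ j = 0" for x
      using sym[of x i j] that by (simp add: X_NN mat_def eq_commute)
    then show ?thesis by simp
  qed
  \<comment> \<open>The claim is symmetric in the two indices, so a leading row with a trailing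
    column reduces to the opposite mixed case.\<close>
  have "X x $ i $ j + X x $ j $ i - D x $ i $ j = X x $ j $ i + X x $ i $ j - D x $ j $ i" for x
    using sym[of x i j] by simp
  then have swap: "(\<lambda>x. X x $ i $ j + X x $ j $ i - D x $ i $ j) = (\<lambda>x. X x $ j $ i + X x $ i $ j - D x $ j $ i)"
    by (rule ext)
  show ?thesis
  proof (cases "i \<in> range (emb :: 'n \<Rightarrow> 'm)")
    case True
    then show ?thesis
      unfolding swap by (cases "j \<in> range (emb :: 'n \<Rightarrow> 'm)") (rule RR NR; assumption)+
  next
    case False
    then show ?thesis
      by (cases "j \<in> range (emb :: 'n \<Rightarrow> 'm)") (rule NR NN; assumption)+
  qed
qed

definition "G' x = G x ** (mat 1 - X x)"
definition "H' x = H x ** (mat 1 - Y x)"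

text \<open>\<open>H (I - Y) - I = -((H - I) Y + (Y - (H - I)))\<close>: the first term is a product
  of two errors, and \<open>Y\<close> agrees with \<open>H - I\<close> to order
  \<open>q\<close>.\<close>

lemma H'_near: "(\<lambda>x. H' x $ i $ j - (if i = j then 1 else 0)) \<in> O[F](q)"
proof -
  have "(\<lambda>x. (H x - mat 1) $ i $ j) \<in> O[F](e)" for i j
    using H_near[of i j] by (simp add: mat_def)
  moreover have "(\<lambda>x. Y x $ i $ j) \<in> O[F](e)" for i j
    using sum_in_bigo(1)[OF q_imp_e[OF Y_near[of i j]] H_near[of i j]] by simp
  ultimately have "(\<lambda>x. ((H x - mat 1) ** Y x) $ i $ j) \<in> O[F](q)"
    by (rule bigo_matrix_mult) (rule gauge_square)
  from sum_in_bigo(1)[OF this Y_near[of i j]]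
  have "(\<lambda>x. - (((H x - mat 1) ** Y x) $ i $ j
      + (Y x $ i $ j - (H x $ i $ j - (if i = j then 1 else 0))))) \<in> O[F](q)"
    by (simp only: landau_o.big.uminus_in_iff)
  then show ?thesis
    by (simp add: H'_def matrix_diff_ldistrib matrix_diff_rdistrib algebra_simps)
qed

text \<open>The identity used for \<open>H'\<close> works for leading rows, because such a row of
  \<open>G - I\<close> is small in every column, trailing ones included.\<close>

lemma G'_near_R_row:
  assumes "i \<in> range (emb :: 'n \<Rightarrow> 'm)"
  shows "(\<lambda>x. G' x $ i $ j - (if i = j then 1 else 0)) \<in> O[F](q)"
proof -
  have "(\<lambda>x. (G x - mat 1) $ i $ k * X x $ k $ j) \<in> O[F](q)" for k
    using G_near[of i k] assms by (intro mult_ee X_small) (simp add: mat_def)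
  then have "(\<lambda>x. ((G x - mat 1) ** X x) $ i $ j) \<in> O[F](q)"
    unfolding matrix_matrix_mult_def by (simp only: vec_lambda_beta) (intro big_sum_in_bigo)
  from sum_in_bigo(1)[OF this X_near_R_row[OF assms, of j]]
  have "(\<lambda>x. - (((G x - mat 1) ** X x) $ i $ j
      + (X x $ i $ j - (G x $ i $ j - (if i = j then 1 else 0))))) \<in> O[F](q)"
    by (simp only: landau_o.big.uminus_in_iff)
  then show ?thesis
    by (simp add: G'_def matrix_diff_ldistrib matrix_diff_rdistrib algebra_simps)
qed

text \<open>
  With \<open>D = G\<^sup>T G - I\<close>, here \<open>X = D - G\<^sup>T + I\<close> up to negligible terms, and \<open>G D = (G G\<^sup>T - I) G\<close>.
  The smallness of \<open>G G\<^sup>T - I\<close> then makes \<open>G X\<close> agree with \<open>G\<close> on this block.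
\<close>

lemma G'_near_NR:
  assumes i: "i \<notin> range (emb :: 'n \<Rightarrow> 'm)"
  shows "(\<lambda>x. G' x $ i $ emb (b :: 'n)) \<in> O[F](q)"
proof -
  let ?j = "emb b :: 'm"
  let ?Z = "\<lambda>x. X x - (D x - transpose (G x) + mat 1)"
  let ?D' = "\<lambda>x. G x ** transpose (G x) - mat 1"
  have ne: "i \<noteq> ?j" using i by auto
  \<comment> \<open>For leading \<open>k\<close> both factors are of order \<open>e\<close>; for
    trailing \<open>k\<close> the entry of \<open>G\<close> is merely bounded, but \<open>?Z\<close>
    is of order \<open>q\<close>.\<close>
  have "(\<lambda>x. G x $ i $ k * ?Z x $ k $ ?j) \<in> O[F](q)" for k
  proof (cases "k \<in> range (emb :: 'n \<Rightarrow> 'm)")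
    case True
    then have "k \<noteq> i" using i by auto
    then have "(\<lambda>x. G x $ i $ k) \<in> O[F](e)"
      using G_near[of i k] True by auto
    moreover have "(\<lambda>x. X x $ k $ ?j - (D x $ k $ ?j - (G x $ ?j $ k - (if ?j = k then 1 else 0)))) \<in> O[F](e)"
      by (intro sum_in_bigo X_small D_small G_near) auto
    then have "(\<lambda>x. ?Z x $ k $ ?j) \<in> O[F](e)"
      by (simp add: transpose_def mat_def algebra_simps eq_commute)
    ultimately show ?thesis by (rule mult_ee)
  next
    case False
    then have "k \<noteq> ?j" by auto
    then have "?Z x $ k $ ?j = X x $ k $ ?j - ((transpose (G x) ** G x) $ k $ ?j - G x $ ?j $ k)" for x
      by (simp add: transpose_def mat_def)
    then have "(\<lambda>x. ?Z x $ k $ ?j) \<in> O[F](q)"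
      using X_near_NR[OF False, of b] by simp
    then show ?thesis by (intro bigo_mult1(2) G_bounded)
  qed
  then have "(\<lambda>x. (G x ** ?Z x) $ i $ ?j) \<in> O[F](q)"
    unfolding matrix_matrix_mult_def[of "G _"] by (simp only: vec_lambda_beta) (intro big_sum_in_bigo)
  moreover have "(\<lambda>x. (?D' x ** (G x - mat 1)) $ i $ ?j) \<in> O[F](q)"
  proof -
    have "(\<lambda>x. ?D' x $ i $ k * (G x - mat 1) $ k $ ?j) \<in> O[F](q)" for k
      using G_near[of k ?j] by (intro mult_ee dual_gram_small) (simp add: mat_def)
    then show ?thesis
      unfolding matrix_matrix_mult_def[of "_ - _"] by (simp only: vec_lambda_beta) (intro big_sum_in_bigo)
  qed
  ultimately have "(\<lambda>x. - ((G x ** ?Z x) $ i $ ?j + (?D' x ** (G x - mat 1)) $ i $ ?j)) \<in> O[F](q)"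
    by (simp only: landau_o.big.uminus_in_iff) (rule sum_in_bigo)
  \<comment> \<open>In full, \<open>G' = I - G Z - D' (G - I)\<close>, by \<open>G D = D' G\<close>
    and \<open>G G^T = I + D'\<close>; the entry of \<open>I\<close> vanishes since \<open>i\<close>
    and \<open>?j\<close> differ.\<close>
  moreover have "G' x $ i $ ?j = - ((G x ** ?Z x) $ i $ ?j + (?D' x ** (G x - mat 1)) $ i $ ?j)" for x
    using ne by (simp add: G'_def matrix_diff_ldistrib matrix_diff_rdistrib matrix_add_ldistrib
      matrix_mul_assoc) (simp add: mat_def)
  ultimately show ?thesis by simp
qed

lemma G'_near:
  assumes "i \<in> range (emb :: 'n \<Rightarrow> 'm) \<or> j \<in> range (emb :: 'n \<Rightarrow> 'm)"
  shows "(\<lambda>x. G' x $ i $ j - (if i = j then 1 else 0)) \<in> O[F](q)"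
proof (cases "i \<in> range (emb :: 'n \<Rightarrow> 'm)")
  case True
  then show ?thesis by (rule G'_near_R_row)
next
  case False
  with assms obtain b :: 'n where "j = emb b" by auto
  moreover have "i \<noteq> j" using False assms by auto
  ultimately show ?thesis using G'_near_NR[OF False, of b] by simp
qed

text \<open>Expand \<open>(I - X^T) (I + D) (I - X)\<close>. The first-order part
  \<open>D - X - X^T\<close> is negligible by \<open>X_symmetric_part\<close>, and every other term
  contains two small factors. No nearness of \<open>G\<close> to \<open>I\<close> is involved, so
  the trailing block is covered.\<close>

lemma G'_gram: "(\<lambda>x. (transpose (G' x) ** G' x) $ i $ j - (if i = j then 1 else 0)) \<in> O[F](q)"
proof -
  let ?T = "\<lambda>x. transpose (X x)"
  have T: "(\<lambda>x. ?T x $ i $ j) \<in> O[F](e)" for i j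
    using X_small by (simp add: transpose_def)
  have T1: "(\<lambda>x. (mat 1 - ?T x) $ i $ j) \<in> O[F](\<lambda>_. 1)" for i j
    using e_imp_1[OF T] by (auto intro: sum_in_bigo)
  have "(\<lambda>x. (D x ** X x) $ i $ j) \<in> O[F](q)" for i j
    by (rule bigo_matrix_mult[OF D_small X_small gauge_square])
  then have "(\<lambda>x. ((mat 1 - ?T x) ** (D x ** X x)) $ i $ j) \<in> O[F](q)"
    by (rule bigo_matrix_mult[OF T1]) simp
  moreover have "(\<lambda>x. (?T x ** X x) $ i $ j) \<in> O[F](q)" "(\<lambda>x. (?T x ** D x) $ i $ j) \<in> O[F](q)"
    by (rule bigo_matrix_mult[OF T X_small gauge_square])
       (rule bigo_matrix_mult[OF T D_small gauge_square])
  ultimately have "(\<lambda>x. (?T x ** X x) $ i $ j - (?T x ** D x) $ i $ j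
      - ((mat 1 - ?T x) ** (D x ** X x)) $ i $ j - (X x $ i $ j + X x $ j $ i - D x $ i $ j)) \<in> O[F](q)"
    by (intro sum_in_bigo X_symmetric_part)
  moreover have "(transpose (G' x) ** G' x) - mat 1
      = ?T x ** X x - ?T x ** D x - (mat 1 - ?T x) ** (D x ** X x) - (X x + ?T x - D x)" for x
    by (simp add: G'_def matrix_transpose_mul transpose_diff matrix_diff_ldistrib
      matrix_diff_rdistrib matrix_mul_assoc)
  then have "(transpose (G' x) ** G' x) $ i $ j - (if i = j then 1 else 0)
      = (?T x ** X x) $ i $ j - (?T x ** D x) $ i $ j
      - ((mat 1 - ?T x) ** (D x ** X x)) $ i $ j - (X x $ i $ j + X x $ j $ i - D x $ i $ j)" for x
    by (simp add: vec_eq_iff) (simp add: mat_def transpose_def algebra_simps)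
  ultimately show ?thesis by simp
qed

text \<open>The first-order parts cancel: the diagonal entry of \<open>W\<close> expands to
  \<open>\<sigma> a * (G + H - 1)\<close>, with \<open>G\<close> and \<open>H\<close> standing for
  their diagonal entries, and the normalising term expands to the same expression.\<close>

lemma resid_small: "(\<lambda>x. resid \<sigma> (rect_diag \<sigma>) (G x) (H x) $ a) \<in> O[F](q)"
proof -
  let ?p = "\<lambda>x. (\<Sum>l\<in>UNIV. \<sigma> l * G x $ emb l $ emb a * H x $ l $ a)
      - (\<Sum>l\<in>UNIV. \<sigma> l * ((if l = a then 1 else 0) * H x $ l $ a
          + G x $ emb l $ emb a * (if l = a then 1 else 0)
          - (if l = a then 1 else 0) * (if l = a then 1 else 0)))"
  have p: "?p x = (transpose (G x) ** rect_diag \<sigma> ** H x) $ emb a $ a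
      - \<sigma> a * (H x $ a $ a + G x $ emb a $ emb a - 1)" for x
    by (simp add: transpose_rect_diag_mult if_distrib[of "\<lambda>y. _ * y"] if_distrib[of "\<lambda>y. y * _"]
      algebra_simps sum.distrib sum_subtractf cong: if_cong)
  have "?p \<in> O[F](q)"
    by (intro bilinear_linearization G_near_emb H_near)
  moreover have "(\<lambda>x. ((transpose (G x) ** G x) $ emb a $ emb a
      - (G x $ emb a $ emb a + G x $ emb a $ emb a - (if (emb a :: 'm) = emb a then 1 else 0)))
      + ((transpose (H x) ** H x) $ a $ a
      - (H x $ a $ a + H x $ a $ a - (if a = a then 1 else 0)))) \<in> O[F](q)"
    by (intro sum_in_bigo(1) gram_near gram_near_H) auto
  then have "(\<lambda>x. \<sigma> a / 2 * (((transpose (G x) ** G x) $ emb a $ emb a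
      - (G x $ emb a $ emb a + G x $ emb a $ emb a - (if (emb a :: 'm) = emb a then 1 else 0)))
      + ((transpose (H x) ** H x) $ a $ a
      - (H x $ a $ a + H x $ a $ a - (if a = a then 1 else 0))))) \<in> O[F](q)"
    by (rule bigo_mult1(2)[OF bigo_const])
  ultimately have "(\<lambda>x. ?p x - \<sigma> a / 2 * (((transpose (G x) ** G x) $ emb a $ emb a
      - (G x $ emb a $ emb a + G x $ emb a $ emb a - (if (emb a :: 'm) = emb a then 1 else 0)))
      + ((transpose (H x) ** H x) $ a $ a
      - (H x $ a $ a + H x $ a $ a - (if a = a then 1 else 0))))) \<in> O[F](q)"
    by (rule sum_in_bigo(2))
  then show ?thesis
    unfolding p by (simp add: resid_entry algebra_simps)
qed

text \<open>Telescoping \<open>G^T A H - A = (G - I)^T A H + A (H - I)\<close>. Only leading columns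
  of \<open>G\<close> enter, and these are near unit vectors.\<close>

lemma jac_mat_near:
  assumes "\<And>j k l. (\<lambda>x. A x j $ k $ l) \<in> O[F](\<lambda>_. 1)"
  shows "(\<lambda>x. (jac_mat (A x) (G x) (H x) - jac_mat (A x) (mat 1) (mat 1)) $ a $ b) \<in> O[F](e)"
proof -
  let ?P = "\<lambda>x. transpose (G x - mat 1)"
  have H1: "(\<lambda>x. (H x - mat 1) $ i $ j) \<in> O[F](e)" for i j
    using H_near[of i j] by (simp add: mat_def)
  have "(\<lambda>x. (A x b ** H x) $ k $ l) \<in> O[F](\<lambda>_. 1)" for k l
    by (rule bigo_matrix_mult[OF assms H_bounded]) simp
  moreover have "(\<lambda>x. ?P x $ emb a $ k) \<in> O[F](e)" for k
    using G_near[of k "emb a"] by (simp add: mat_def transpose_def)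
  ultimately have "(\<lambda>x. (?P x ** (A x b ** H x)) $ emb a $ a) \<in> O[F](e)"
    unfolding matrix_matrix_mult_def[of "transpose _"]
    by (simp only: vec_lambda_beta) (intro big_sum_in_bigo bigo_mult1(1))
  moreover have "(\<lambda>x. (A x b ** (H x - mat 1)) $ emb a $ a) \<in> O[F](e)"
    by (rule bigo_matrix_mult[OF assms H1]) simp
  ultimately have "(\<lambda>x. (?P x ** (A x b ** H x)) $ emb a $ a
      + (A x b ** (H x - mat 1)) $ emb a $ a) \<in> O[F](e)"
    by (rule sum_in_bigo)
  then show ?thesis
    by (simp add: jac_mat_entry transpose_diff matrix_diff_ldistrib matrix_diff_rdistrib
      matrix_mul_assoc transpose_mat)
qed

end

section \<open>Cubic contraction of the normalised iteration\<close>

lemma affine_mat_shift: "affine_mat A0 A c = affine_mat (affine_mat A0 A cs) A (c - cs)"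
  by (simp add: affine_mat_def scaleR_diff_left sum_subtractf)

lemma bigo_matrix_vector_mult:
  fixes M :: "'a \<Rightarrow> ('m::finite, 'k::finite) rmat" and w :: "'a \<Rightarrow> 'k rvec"
  assumes "\<And>i j. (\<lambda>x. M x $ i $ j) \<in> O[F](f)" and "\<And>i. (\<lambda>x. w x $ i) \<in> O[F](g)"
    and "(\<lambda>x. f x * g x) \<in> O[F](h)"
  shows "(\<lambda>x. (M x *v w x) $ i) \<in> O[F](h)"
  unfolding matrix_vector_mult_def
  by (simp, intro big_sum_in_bigo landau_o.big_trans[OF landau_o.big.mult[OF assms(1,2)] assms(3)])

lemma bigo_norm_matrix:
  fixes M :: "'a \<Rightarrow> ('m::finite, 'n::finite) rmat"
  assumes "\<And>i j. (\<lambda>x. M x $ i $ j) \<in> O[F](f)"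
  shows "(\<lambda>x. norm (M x)) \<in> O[F](f)"
proof -
  have "(\<lambda>x. \<Sum>i\<in>UNIV. \<Sum>j\<in>UNIV. \<bar>M x $ i $ j\<bar>) \<in> O[F](f)"
    using assms by (intro big_sum_in_bigo) simp
  then show ?thesis
    by (elim landau_o.big_trans[rotated], intro landau_o.big_mono always_eventually allI)
       (simp add: order.trans[OF norm_le_sum_entries abs_ge_self])
qed

lemma bigo_norm_vector:
  fixes w :: "'a \<Rightarrow> 'n::finite rvec"
  assumes "\<And>i. (\<lambda>x. w x $ i) \<in> O[F](f)"
  shows "(\<lambda>x. norm (w x)) \<in> O[F](f)"
proof -
  have "(\<lambda>x. \<Sum>i\<in>UNIV. \<bar>w x $ i\<bar>) \<in> O[F](f)"
    using assms by (intro big_sum_in_bigo) simp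
  then show ?thesis
    by (elim landau_o.big_trans[rotated], intro landau_o.big_mono always_eventually allI)
       (simp add: norm_le_l1_cart)
qed

lemma mat_2: "mat 2 = (mat 1 + mat 1 :: ('n::finite, 'n) rmat)"
  by (simp add: mat_def vec_eq_iff)

text \<open>Moving the right factor \<open>J\<close> through the product turns \<open>J B\<close>
  into \<open>B J\<close>, and with \<open>t = B J\<close> the left side is
  \<open>1 - t - t (2 - t) (1 - t) = (1 - t)^3\<close>.\<close>

lemma chebyshev_cube:
  "mat 1 - (B + B ** (mat 2 - J ** B) ** (mat 1 - J ** B)) ** J
    = (mat 1 - B ** J) ** (mat 1 - B ** J) ** (mat 1 - B ** J)"
  for B J :: "('n::finite, 'n) rmat"
  by (simp only: mat_2 matrix_diff_ldistrib matrix_diff_rdistrib matrix_add_ldistrib matrix_add_rdistrib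
    matrix_mul_assoc matrix_mul_lid matrix_mul_rid) (simp add: algebra_simps)

section \<open>Orders of the errors along one full step\<close>

definition cf_error :: "('n::{finite,linorder}, 'n) rmat \<Rightarrow> 'n rvec
    \<Rightarrow> 'n rvec \<times> ('m::{finite,linorder}, 'm) rmat \<times> ('n, 'n) rmat \<times> ('n, 'n) rmat \<Rightarrow> real" where
  "cf_error K cs = (\<lambda>(c, G, H, B).
     norm (c - cs)
     + norm ((\<chi> i j. if i \<in> range (emb :: 'n \<Rightarrow> 'm) \<or> j \<in> range (emb :: 'n \<Rightarrow> 'm)
         then (G - mat 1) $ i $ j else 0) :: ('m, 'm) rmat)
     + norm (transpose G ** G - mat 1) + norm (H - mat 1) + norm (B - K))"

text \<open>The matrices \<open>A0\<close> and \<open>A\<close> vary with the configuration, since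
  the rotation of coordinates depends on the starting singular vectors; \<open>\<sigma>\<close>,
  \<open>K\<close> and \<open>cs\<close> stay fixed. The Landau constants are thereby uniform over
  all rotated problems.\<close>

locale cubic_step =
  fixes F :: "'a filter" and e :: "'a \<Rightarrow> real"
    and \<sigma> :: "'n::{finite,linorder} \<Rightarrow> real"
    and K :: "('n, 'n) rmat" and cs :: "'n rvec"
    and A0 :: "'a \<Rightarrow> ('m::{finite,linorder}, 'n) rmat"
    and A :: "'a \<Rightarrow> 'n \<Rightarrow> ('m, 'n) rmat"
    and c :: "'a \<Rightarrow> 'n rvec"
    and G :: "'a \<Rightarrow> ('m, 'm) rmat"
    and H :: "'a \<Rightarrow> ('n, 'n) rmat"
    and B :: "'a \<Rightarrow> ('n, 'n) rmat"
  assumes e_bounded: "e \<in> O[F](\<lambda>_. 1)"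
    and card_le: "CARD('n) \<le> CARD('m)"
    and sigma_distinct: "\<And>a b. a \<noteq> b \<Longrightarrow> (\<sigma> a)\<^sup>2 - (\<sigma> b)\<^sup>2 \<noteq> 0"
    and sigma_nonzero: "\<And>a. \<sigma> a \<noteq> 0"
    and solution: "\<And>x. affine_mat (A0 x) (A x) cs = rect_diag \<sigma>"
    and A_bounded: "\<And>j k l. (\<lambda>x. A x j $ k $ l) \<in> O[F](\<lambda>_. 1)"
    and K_inverse: "eventually (\<lambda>x. K ** jac_mat (A x) (mat 1) (mat 1) = mat 1) F"
    and c_near: "\<And>a. (\<lambda>x. (c x - cs) $ a) \<in> O[F](e)"
    and G_near: "\<And>i j. i \<in> range (emb :: 'n \<Rightarrow> 'm) \<or> j \<in> range (emb :: 'n \<Rightarrow> 'm) \<Longrightarrow>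
      (\<lambda>x. G x $ i $ j - (if i = j then 1 else 0)) \<in> O[F](e)"
    and G_gram: "\<And>i j. (\<lambda>x. (transpose (G x) ** G x) $ i $ j - (if i = j then 1 else 0)) \<in> O[F](e)"
    and H_near: "\<And>i j. (\<lambda>x. H x $ i $ j - (if i = j then 1 else 0)) \<in> O[F](e)"
    and B_near: "\<And>i j. (\<lambda>x. (B x - K) $ i $ j) \<in> O[F](e)"
begin

lemma e_power_bounded: "(\<lambda>x. e x ^ p) \<in> O[F](\<lambda>_. 1)"
  using landau_o.big_power[OF e_bounded, of p] by simp

lemma e_power_mono:
  assumes "p \<le> r" shows "(\<lambda>x. e x ^ r) \<in> O[F](\<lambda>x. e x ^ p)"
proof -
  have "(\<lambda>x. e x ^ p * e x ^ (r - p)) \<in> O[F](\<lambda>x. e x ^ p * 1)"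
    by (intro landau_o.big.mult_left e_power_bounded)
  then show ?thesis using assms by (simp add: power_add[symmetric])
qed

text \<open>For bounded \<open>e\<close>, the two exponent conditions give the two comparisons
  between \<open>e\<close> and \<open>q\<close> required of a gauge.\<close>

lemma gauge_power:
  assumes "p \<le> r" "r \<le> 2 * p"
  shows "gauge F (\<lambda>x. e x ^ p) (\<lambda>x. e x ^ r)"
  using e_power_mono[OF assms(1)] e_power_mono[OF assms(2)]
  by unfold_locales (simp_all add: e_power_bounded power_add[symmetric] mult_2)

abbreviation "J0 x \<equiv> jac_mat (A x) (mat 1) (mat 1)"
abbreviation "E_at w x \<equiv> affine_mat (A0 x) (A x) (w x) - rect_diag \<sigma>"

lemma E_at_small:
  assumes "\<And>a. (\<lambda>x. (w x - cs) $ a) \<in> O[F](f)"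
  shows "(\<lambda>x. E_at w x $ k $ l) \<in> O[F](f)"
proof -
  have "(\<lambda>x. \<Sum>a\<in>UNIV. (w x - cs) $ a * A x a $ k $ l) \<in> O[F](f)"
    by (intro big_sum_in_bigo bigo_mult1(1) assms A_bounded)
  moreover have "E_at w x $ k $ l = (\<Sum>a\<in>UNIV. (w x - cs) $ a * A x a $ k $ l)" for x
    by (subst affine_mat_shift[of _ _ "w x" cs], subst solution)
       (simp add: affine_mat_def)
  ultimately show ?thesis by simp
qed

lemma B_bounded: "(\<lambda>x. B x $ i $ j) \<in> O[F](\<lambda>_. 1)"
  using sum_in_bigo(1)[OF landau_o.big_trans[OF B_near[of i j] e_bounded] bigo_const[of "K $ i $ j"]] by simp

lemma J0_bounded: "(\<lambda>x. J0 x $ i $ j) \<in> O[F](\<lambda>_. 1)"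
proof -
  have "(\<lambda>x. (transpose (mat 1) ** A x j) $ k $ l) \<in> O[F](\<lambda>_. 1)" for k l
    by (rule bigo_matrix_mult[OF _ A_bounded, where f = "\<lambda>_. 1"]) simp_all
  then show ?thesis
    unfolding jac_mat_entry by (rule bigo_matrix_mult[where f = "\<lambda>_. 1" and g = "\<lambda>_. 1"]) simp_all
qed

text \<open>\<open>I - B J = (K - B) J + K (J\<^sub>0 - J)\<close> whenever \<open>K J\<^sub>0 = I\<close>.\<close>

lemma BJ_near:
  assumes "\<And>i j. (\<lambda>x. (J x - J0 x) $ i $ j) \<in> O[F](e)"
  shows "(\<lambda>x. (mat 1 - B x ** J x) $ i $ j) \<in> O[F](e)"
proof -
  have J: "(\<lambda>x. J x $ i $ j) \<in> O[F](\<lambda>_. 1)" for i j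
    using sum_in_bigo(1)[OF landau_o.big_trans[OF assms[of i j] e_bounded] J0_bounded[of i j]] by simp
  have "(\<lambda>x. ((B x - K) ** J x) $ i $ j) \<in> O[F](e)"
    by (rule bigo_matrix_mult[OF B_near J]) simp
  moreover have "(\<lambda>x. (K ** (J x - J0 x)) $ i $ j) \<in> O[F](e)"
    by (rule bigo_matrix_mult[OF _ assms, where f = "\<lambda>_. 1"]) simp_all
  ultimately have "(\<lambda>x. - (((B x - K) ** J x) $ i $ j + (K ** (J x - J0 x)) $ i $ j)) \<in> O[F](e)"
    by (simp only: landau_o.big.uminus_in_iff) (rule sum_in_bigo)
  moreover have "eventually (\<lambda>x. - (((B x - K) ** J x) $ i $ j + (K ** (J x - J0 x)) $ i $ j)
      = (mat 1 - B x ** J x) $ i $ j) F"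
    using K_inverse by eventually_elim (simp add: matrix_diff_ldistrib matrix_diff_rdistrib)
  ultimately show ?thesis by (simp only: landau_o.big.in_cong)
qed

text \<open>The new error is \<open>(I - B J) (w - cs) - B r\<close>, and \<open>I - B J\<close> is
  of order \<open>e\<close>. Each correction with the same \<open>B\<close> thus gains one factor
  \<open>e\<close>; the two uses take \<open>f = e\<close> and \<open>f = e^2\<close>.\<close>

lemma correction_near:
  assumes J: "\<And>i j. (\<lambda>x. (J x - J0 x) $ i $ j) \<in> O[F](e)"
    and w: "\<And>a. (\<lambda>x. (w x - cs) $ a) \<in> O[F](f)"
    and r: "\<And>a. (\<lambda>x. r x $ a) \<in> O[F](\<lambda>x. e x * f x)"
  shows "(\<lambda>x. (w x - B x *v (J x *v (w x - cs) + r x) - cs) $ a) \<in> O[F](\<lambda>x. e x * f x)"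
proof -
  have "(\<lambda>x. ((mat 1 - B x ** J x) *v (w x - cs)) $ a) \<in> O[F](\<lambda>x. e x * f x)"
    by (rule bigo_matrix_vector_mult[OF BJ_near[OF J] w]) simp
  moreover have "(\<lambda>x. (B x *v r x) $ a) \<in> O[F](\<lambda>x. e x * f x)"
    by (rule bigo_matrix_vector_mult[OF B_bounded r]) simp
  ultimately have "(\<lambda>x. ((mat 1 - B x ** J x) *v (w x - cs)) $ a - (B x *v r x) $ a) \<in> O[F](\<lambda>x. e x * f x)"
    by (rule sum_in_bigo)
  moreover have eq: "w - B *v (J *v (w - cs) + r) - cs = (mat 1 - B ** J) *v (w - cs) - B *v r" for w r B J
    by (simp add: matrix_vector_mult_diff_rdistrib matrix_vector_right_distrib matrix_vector_mul_assoc)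
  ultimately show ?thesis by (simp only: eq vector_minus_component)
qed

lemma resid_at:
  "resid \<sigma> (affine_mat (A0 x) (A x) w) U V
    = jac_mat (A x) U V *v (w - cs) + resid \<sigma> (rect_diag \<sigma>) U V"
  by (subst affine_mat_shift[of _ _ w cs], subst solution) (rule resid_affine_mat)

text \<open>The residual and Jacobian estimates do not involve \<open>E\<close>, so
  \<open>E = 0\<close> serves to bound \<open>c1\<close> before the matrix at \<open>c1\<close> can
  be used as a small perturbation.\<close>

sublocale h0: half_step F e "\<lambda>x. e x ^ 2" \<sigma> G H "\<lambda>_. 0"
proof -
  interpret gauge F e "\<lambda>x. e x ^ 2" using gauge_power[of 1 2] by simp
  show "half_step F e (\<lambda>x. e x ^ 2) \<sigma> G H (\<lambda>_. 0)"
    using card_le sigma_distinct sigma_nonzero G_near G_gram H_near by unfold_locales simp_all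
qed

definition "J x = jac_mat (A x) (G x) (H x)"
definition "c1 x = c x - B x *v (J x *v (c x - cs) + resid \<sigma> (rect_diag \<sigma>) (G x) (H x))"

lemma J_near: "(\<lambda>x. (J x - J0 x) $ i $ j) \<in> O[F](e)"
  unfolding J_def by (rule h0.jac_mat_near[OF A_bounded])

lemma c1_near: "(\<lambda>x. (c1 x - cs) $ a) \<in> O[F](\<lambda>x. e x ^ 2)"
  using correction_near[OF J_near c_near, of "\<lambda>x. resid \<sigma> (rect_diag \<sigma>) (G x) (H x)" a] h0.resid_small
  by (simp add: c1_def power2_eq_square)

sublocale h1: half_step F e "\<lambda>x. e x ^ 2" \<sigma> G H "E_at c1"
  by unfold_locales
    (rule card_le sigma_distinct sigma_nonzero G_near G_gram H_near E_at_small[OF c1_near]; assumption)+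

definition "G1 = h1.G'"
definition "H1 = h1.H'"

text \<open>All errors in \<open>G1\<close> and \<open>H1\<close> are now of order
  \<open>e^2\<close>. The target is \<open>e^3\<close> rather than \<open>e^4\<close>, because the
  second correction of the parameter reaches only that order.\<close>

sublocale h2: half_step F "\<lambda>x. e x ^ 2" "\<lambda>x. e x ^ 3" \<sigma> G1 H1 "\<lambda>_. 0"
proof -
  interpret gauge F "\<lambda>x. e x ^ 2" "\<lambda>x. e x ^ 3" by (rule gauge_power) simp_all
  show "half_step F (\<lambda>x. e x ^ 2) (\<lambda>x. e x ^ 3) \<sigma> G1 H1 (\<lambda>_. 0)"
    using card_le sigma_distinct sigma_nonzero h1.G'_near h1.G'_gram h1.H'_near
    unfolding G1_def H1_def by unfold_locales simp_all
qed

definition "J1 x = jac_mat (A x) (G1 x) (H1 x)"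
definition "c2 x = c1 x - B x *v (J1 x *v (c1 x - cs) + resid \<sigma> (rect_diag \<sigma>) (G1 x) (H1 x))"

lemma J1_near: "(\<lambda>x. (J1 x - J0 x) $ i $ j) \<in> O[F](e)"
  using landau_o.big_trans[OF h2.jac_mat_near[OF A_bounded] e_power_mono[of 1 2]] by (simp add: J1_def)

lemma c2_near: "(\<lambda>x. (c2 x - cs) $ a) \<in> O[F](\<lambda>x. e x ^ 3)"
  using correction_near[OF J1_near c1_near, of "\<lambda>x. resid \<sigma> (rect_diag \<sigma>) (G1 x) (H1 x)" a] h2.resid_small
  by (simp add: c2_def power2_eq_square power3_eq_cube mult.assoc)

sublocale h3: half_step F "\<lambda>x. e x ^ 2" "\<lambda>x. e x ^ 3" \<sigma> G1 H1 "E_at c2"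
  by unfold_locales
    (rule card_le sigma_distinct sigma_nonzero h2.G_near h2.G_gram h2.H_near E_at_small[OF c2_near]; assumption)+

definition "G2 = h3.G'"
definition "H2 = h3.H'"

text \<open>Only the first-order conclusions are wanted after the last half-step, so both gauges are
  the final order \<open>e^3\<close>.\<close>

sublocale h4: half_step F "\<lambda>x. e x ^ 3" "\<lambda>x. e x ^ 3" \<sigma> G2 H2 "\<lambda>_. 0"
proof -
  interpret gauge F "\<lambda>x. e x ^ 3" "\<lambda>x. e x ^ 3" by (rule gauge_power) simp_all
  show "half_step F (\<lambda>x. e x ^ 3) (\<lambda>x. e x ^ 3) \<sigma> G2 H2 (\<lambda>_. 0)"
    using card_le sigma_distinct sigma_nonzero h3.G'_near h3.G'_gram h3.H'_near
    unfolding G2_def H2_def by unfold_locales simp_all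
qed

definition "J2 x = jac_mat (A x) (G2 x) (H2 x)"
definition "B2 x = B x + B x ** (mat 2 - J2 x ** B x) ** (mat 1 - J2 x ** B x)"

lemma J2_near: "(\<lambda>x. (J2 x - J0 x) $ i $ j) \<in> O[F](\<lambda>x. e x ^ 3)"
  using h4.jac_mat_near[OF A_bounded] by (simp add: J2_def)

lemma cf_step_eq: "cf_step (A0 x) (A x) \<sigma> (c x, G x, H x, B x) = (c2 x, G2 x, H2 x, B2 x)"
proof -
  have c1: "c x - B x *v (jac_mat (A x) (G x) (H x) *v c x + resid \<sigma> (A0 x) (G x) (H x)) = c1 x"
    using resid_at[of x "c x" "G x" "H x"] by (simp add: c1_def J_def resid_affine_mat)
  have G1: "G x ** (mat 1 - X_corr \<sigma> (transpose (G x) ** affine_mat (A0 x) (A x) (c1 x) ** H x) (G x) (H x)) = G1 x"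
    by (simp add: G1_def h1.G'_def h1.X_def h1.W_def)
  have H1: "H x ** (mat 1 - Y_corr \<sigma> (transpose (G x) ** affine_mat (A0 x) (A x) (c1 x) ** H x) (G x) (H x)) = H1 x"
    by (simp add: H1_def h1.H'_def h1.Y_def h1.W_def)
  have c2: "c1 x - B x *v resid \<sigma> (affine_mat (A0 x) (A x) (c1 x)) (G1 x) (H1 x) = c2 x"
    by (simp add: c2_def J1_def resid_at)
  have G2: "G1 x ** (mat 1 - X_corr \<sigma> (transpose (G1 x) ** affine_mat (A0 x) (A x) (c2 x) ** H1 x) (G1 x) (H1 x)) = G2 x"
    by (simp add: G2_def h3.G'_def h3.X_def h3.W_def)
  have H2: "H1 x ** (mat 1 - Y_corr \<sigma> (transpose (G1 x) ** affine_mat (A0 x) (A x) (c2 x) ** H1 x) (G1 x) (H1 x)) = H2 x"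
    by (simp add: H2_def h3.H'_def h3.Y_def h3.W_def)
  show ?thesis
    by (simp only: cf_step_def prod.case Let_def c1 G1 H1 c2 G2 H2) (simp add: B2_def J2_def)
qed

text \<open>The defect \<open>I - B2 J2\<close> is the cube of a matrix of order \<open>e\<close>.
  It is turned into a distance from \<open>K\<close> by
  \<open>B2 - K = -((I - B2 J2) K + B2 (J2 - J0) K)\<close>, which uses
  \<open>J0 K = I\<close>.\<close>

lemma B2_near: "(\<lambda>x. (B2 x - K) $ i $ j) \<in> O[F](\<lambda>x. e x ^ 3)"
proof -
  have J2e: "(\<lambda>x. (J2 x - J0 x) $ i $ j) \<in> O[F](e)" for i j
    using landau_o.big_trans[OF J2_near e_power_mono[of 1 3]] by simp
  have J2: "(\<lambda>x. J2 x $ i $ j) \<in> O[F](\<lambda>_. 1)" for i j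
    using sum_in_bigo(1)[OF landau_o.big_trans[OF J2e[of i j] e_bounded] J0_bounded[of i j]] by simp
  have JB: "(\<lambda>x. (J2 x ** B x) $ i $ j) \<in> O[F](\<lambda>_. 1)" for i j
    by (rule bigo_matrix_mult[OF J2 B_bounded]) simp
  have m: "(\<lambda>x. (mat k - J2 x ** B x) $ i $ j) \<in> O[F](\<lambda>_. 1)" for i j k
    using sum_in_bigo(2)[OF bigo_const[of "mat k $ i $ j"] JB[of i j]] by simp
  have "(\<lambda>x. (B x ** (mat 2 - J2 x ** B x)) $ i $ j) \<in> O[F](\<lambda>_. 1)" for i j
    by (rule bigo_matrix_mult[OF B_bounded m]) simp
  then have "(\<lambda>x. (B x ** (mat 2 - J2 x ** B x) ** (mat 1 - J2 x ** B x)) $ i $ j) \<in> O[F](\<lambda>_. 1)" for i j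
    by (rule bigo_matrix_mult[OF _ m]) simp
  then have B2: "(\<lambda>x. B2 x $ i $ j) \<in> O[F](\<lambda>_. 1)" for i j
    using sum_in_bigo(1)[OF B_bounded] by (simp add: B2_def)
  note S = BJ_near[OF J2e]
  have "(\<lambda>x. ((mat 1 - B x ** J2 x) ** (mat 1 - B x ** J2 x)) $ i $ j) \<in> O[F](\<lambda>x. e x ^ 2)" for i j
    by (rule bigo_matrix_mult[OF S S]) (simp add: power2_eq_square)
  then have "(\<lambda>x. ((mat 1 - B x ** J2 x) ** (mat 1 - B x ** J2 x) ** (mat 1 - B x ** J2 x)) $ i $ j)
      \<in> O[F](\<lambda>x. e x ^ 3)" for i j
    by (rule bigo_matrix_mult[OF _ S]) (simp add: power2_eq_square power3_eq_cube)
  then have T: "(\<lambda>x. (mat 1 - B2 x ** J2 x) $ i $ j) \<in> O[F](\<lambda>x. e x ^ 3)" for i j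
    by (simp only: B2_def chebyshev_cube)
  have "(\<lambda>x. ((mat 1 - B2 x ** J2 x) ** K) $ i $ j) \<in> O[F](\<lambda>x. e x ^ 3)"
    by (rule bigo_matrix_mult[OF T, where g = "\<lambda>_. 1"]) simp_all
  moreover have "(\<lambda>x. ((J2 x - J0 x) ** K) $ i $ j) \<in> O[F](\<lambda>x. e x ^ 3)" for i j
    by (rule bigo_matrix_mult[OF J2_near, where g = "\<lambda>_. 1"]) simp_all
  then have "(\<lambda>x. (B2 x ** ((J2 x - J0 x) ** K)) $ i $ j) \<in> O[F](\<lambda>x. e x ^ 3)"
    by (rule bigo_matrix_mult[OF B2]) simp
  ultimately have "(\<lambda>x. - (((mat 1 - B2 x ** J2 x) ** K) $ i $ j + (B2 x ** ((J2 x - J0 x) ** K)) $ i $ j))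
      \<in> O[F](\<lambda>x. e x ^ 3)"
    by (simp only: landau_o.big.uminus_in_iff) (rule sum_in_bigo)
  moreover have "eventually (\<lambda>x. - (((mat 1 - B2 x ** J2 x) ** K) $ i $ j + (B2 x ** ((J2 x - J0 x) ** K)) $ i $ j)
      = (B2 x - K) $ i $ j) F"
    using K_inverse
  proof eventually_elim
    case (elim x)
    then have "J0 x ** K = mat 1" by (simp add: matrix_left_right_inverse)
    then show ?case
      by (simp add: matrix_diff_ldistrib matrix_diff_rdistrib matrix_mul_assoc[symmetric])
  qed
  ultimately show ?thesis by (simp only: landau_o.big.in_cong)
qed

lemma cf_error_cubic:
  "(\<lambda>x. cf_error K cs (cf_step (A0 x) (A x) \<sigma> (c x, G x, H x, B x))) \<in> O[F](\<lambda>x. e x ^ 3)"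
proof -
  have "(\<lambda>x. (if P then (G2 x - mat 1) $ i $ j else 0)) \<in> O[F](\<lambda>x. e x ^ 3)"
    if "P \<Longrightarrow> i \<in> range (emb :: 'n \<Rightarrow> 'm) \<or> j \<in> range (emb :: 'n \<Rightarrow> 'm)" for i j P
    using h4.G_near[of i j] that by (cases P) (simp_all add: mat_def)
  moreover have "(\<lambda>x. (transpose (G2 x) ** G2 x - mat 1) $ i $ j) \<in> O[F](\<lambda>x. e x ^ 3)" for i j
    by (rule h4.D_small)
  moreover have "(\<lambda>x. (H2 x - mat 1) $ i $ j) \<in> O[F](\<lambda>x. e x ^ 3)" for i j
    using h4.H_near[of i j] by (simp add: mat_def)
  ultimately show ?thesis
    unfolding cf_step_eq cf_error_def prod.case
    by (intro sum_in_bigo(1) bigo_norm_matrix bigo_norm_vector c2_near B2_near) simp_all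
qed

end

section \<open>A cubic bound uniform over all admissible configurations\<close>

lemma bigo_principalI: "(\<And>x. x \<in> S \<Longrightarrow> \<bar>f x\<bar> \<le> k * \<bar>g x\<bar>) \<Longrightarrow> f \<in> O[principal S](g)"
  for f g :: "'a \<Rightarrow> real"
  by (rule bigoI[of _ k]) (simp add: eventually_principal)

text \<open>A Landau bound along the principal filter of a set is one constant valid at every point
  of that set, so the locale is interpreted on the set of all bounded problems with states of error
  at most one.\<close>

theorem cf_step_cubic:
  fixes \<sigma> :: "'n::{finite,linorder} \<Rightarrow> real" and K :: "('n, 'n) rmat" and cs :: "'n rvec"
  assumes card_le: "CARD('n) \<le> CARD('m::{finite,linorder})"
    and sigma_distinct: "\<And>a b. a \<noteq> b \<Longrightarrow> (\<sigma> a)\<^sup>2 - (\<sigma> b)\<^sup>2 \<noteq> 0"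
    and sigma_nonzero: "\<And>a. \<sigma> a \<noteq> 0"
  shows "\<exists>C>0. \<forall>(A0 :: ('m, 'n) rmat) A
      (s :: 'n rvec \<times> ('m, 'm) rmat \<times> ('n, 'n) rmat \<times> ('n, 'n) rmat).
    (\<forall>j. norm (A j) \<le> \<beta>) \<and> affine_mat A0 A cs = rect_diag \<sigma>
    \<and> K ** jac_mat A (mat 1) (mat 1) = mat 1 \<and> cf_error K cs s \<le> 1
    \<longrightarrow> cf_error K cs (cf_step A0 A \<sigma> s) \<le> C * cf_error K cs s ^ 3"
proof -
  let ?S = "{(A :: 'n \<Rightarrow> ('m, 'n) rmat, s). (\<forall>j. norm (A j) \<le> \<beta>)
    \<and> K ** jac_mat A (mat 1) (mat 1) = mat 1 \<and> cf_error K cs s \<le> 1}"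
  define e where "e = (\<lambda>x :: ('n \<Rightarrow> ('m, 'n) rmat) \<times> 'n rvec \<times> ('m, 'm) rmat \<times> ('n, 'n) rmat \<times> ('n, 'n) rmat.
    cf_error K cs (snd x))"
  \<comment> \<open>The locale demands the solution property at every point and not just eventually,
    so \<open>A0\<close> is computed from \<open>A\<close>; an admissible given \<open>A0'\<close>
    coincides with it.\<close>
  define A0 :: "('n \<Rightarrow> ('m, 'n) rmat) \<times> 'n rvec \<times> ('m, 'm) rmat \<times> ('n, 'n) rmat \<times> ('n, 'n) rmat
    \<Rightarrow> ('m, 'n) rmat" where "A0 = (\<lambda>x. rect_diag \<sigma> - (\<Sum>i\<in>UNIV. cs $ i *\<^sub>R fst x i))"
  have parts: "norm (c - cs) \<le> cf_error K cs (c, G, H, B)"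
    "norm ((\<chi> i j. if i \<in> range (emb :: 'n \<Rightarrow> 'm) \<or> j \<in> range (emb :: 'n \<Rightarrow> 'm)
         then (G - mat 1) $ i $ j else 0) :: ('m, 'm) rmat) \<le> cf_error K cs (c, G, H, B)"
    "norm (transpose G ** G - mat 1) \<le> cf_error K cs (c, G, H, B)"
    "norm (H - mat 1) \<le> cf_error K cs (c, G, H, B)" "norm (B - K) \<le> cf_error K cs (c, G, H, B)"
    for c H B and G :: "('m, 'm) rmat"
    by (simp_all add: cf_error_def)
  have nonneg: "0 \<le> e x" for x
    by (cases x) (auto simp: e_def intro: order.trans[OF norm_ge_zero parts(1)])
  have e_ge: "f \<in> O[F](e)" if "\<And>A c G H B. \<bar>f (A, c, G, H, B)\<bar> \<le> cf_error K cs (c, G, H, B)" for f F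
    using that nonneg by (intro landau_o.big_mono always_eventually) (auto simp: e_def)
  interpret cubic_step "principal ?S" e \<sigma> K cs A0 fst "\<lambda>x. fst (snd x)" "\<lambda>x. fst (snd (snd x))"
    "\<lambda>x. fst (snd (snd (snd x)))" "\<lambda>x. snd (snd (snd (snd x)))"
  proof
    show "e \<in> O[principal ?S](\<lambda>_. 1)"
      using nonneg by (intro bigo_principalI[of _ _ 1]) (auto simp: e_def)
    show "CARD('n) \<le> CARD('m)" by (rule card_le)
    show "(\<sigma> a)\<^sup>2 - (\<sigma> b)\<^sup>2 \<noteq> 0" if "a \<noteq> b" for a b by (rule sigma_distinct[OF that])
    show "\<sigma> a \<noteq> 0" for a by (rule sigma_nonzero)
    show "affine_mat (A0 x) (fst x) cs = rect_diag \<sigma>" for x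
      by (simp add: A0_def affine_mat_def)
    show "(\<lambda>x. fst x j $ k $ l) \<in> O[principal ?S](\<lambda>_. 1)" for j k l
      by (rule bigo_principalI[of _ _ \<beta>]) (auto intro: order.trans[OF matrix_entry_le_norm])
    show "\<forall>\<^sub>F x in principal ?S. K ** jac_mat (fst x) (mat 1) (mat 1) = mat 1"
      by (auto simp: eventually_principal)
    show "(\<lambda>x. (fst (snd x) - cs) $ a) \<in> O[principal ?S](e)" for a
      by (rule e_ge) (use order.trans[OF component_le_norm_cart parts(1)] in simp)
    show "(\<lambda>x. fst (snd (snd x)) $ i $ j - (if i = j then 1 else 0)) \<in> O[principal ?S](e)"
      if "i \<in> range (emb :: 'n \<Rightarrow> 'm) \<or> j \<in> range (emb :: 'n \<Rightarrow> 'm)" for i j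
    proof (rule e_ge)
      fix A c H B and G :: "('m, 'm) rmat"
      from order.trans[OF matrix_entry_le_norm[of _ i j] parts(2)[of G c H B]] that
      show "\<bar>fst (snd (snd (A, c, G, H, B))) $ i $ j - (if i = j then 1 else 0)\<bar> \<le> cf_error K cs (c, G, H, B)"
        by (simp add: mat_def)
    qed
    show "(\<lambda>x. (transpose (fst (snd (snd x))) ** fst (snd (snd x))) $ i $ j - (if i = j then 1 else 0))
        \<in> O[principal ?S](e)" for i j
    proof (rule e_ge)
      fix A c H B and G :: "('m, 'm) rmat"
      from order.trans[OF matrix_entry_le_norm[of _ i j] parts(3)[of G c H B]]
      show "\<bar>(transpose (fst (snd (snd (A, c, G, H, B)))) ** fst (snd (snd (A, c, G, H, B)))) $ i $ j
          - (if i = j then 1 else 0)\<bar> \<le> cf_error K cs (c, G, H, B)"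
        by (simp add: mat_def)
    qed
    show "(\<lambda>x. fst (snd (snd (snd x))) $ i $ j - (if i = j then 1 else 0)) \<in> O[principal ?S](e)" for i j
    proof (rule e_ge)
      fix A c H B and G :: "('m, 'm) rmat"
      from order.trans[OF matrix_entry_le_norm[of _ i j] parts(4)[of H c G B]]
      show "\<bar>fst (snd (snd (snd (A, c, G, H, B)))) $ i $ j - (if i = j then 1 else 0)\<bar> \<le> cf_error K cs (c, G, H, B)"
        by (simp add: mat_def)
    qed
    show "(\<lambda>x. (snd (snd (snd (snd x))) - K) $ i $ j) \<in> O[principal ?S](e)" for i j
      by (rule e_ge) (use order.trans[OF matrix_entry_le_norm[of _ i j] parts(5)] in simp)
  qed
  from landau_o.bigE[OF cf_error_cubic] obtain C where C: "C > 0"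
    "\<forall>x\<in>?S. cf_error K cs (cf_step (A0 x) (fst x) \<sigma> (snd x)) \<le> C * e x ^ 3"
    using nonneg by (auto simp: eventually_principal)
      (smt (verit))
  show ?thesis
  proof (intro exI[of _ C] conjI C(1) allI impI, elim conjE)
    fix A0' :: "('m, 'n) rmat" and A and s :: "'n rvec \<times> ('m, 'm) rmat \<times> ('n, 'n) rmat \<times> ('n, 'n) rmat"
    assume *: "\<forall>j. norm (A j) \<le> \<beta>" "affine_mat A0' A cs = rect_diag \<sigma>"
      "K ** jac_mat A (mat 1) (mat 1) = mat 1" "cf_error K cs s \<le> 1"
    have "A0' = A0 (A, s)"
      using *(2) by (simp add: A0_def affine_mat_def algebra_simps)
    then show "cf_error K cs (cf_step A0' A \<sigma> s) \<le> C * cf_error K cs s ^ 3"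
      using bspec[OF C(2), of "(A, s)"] * by (simp add: e_def)
  qed
qed

section \<open>Orthogonal change of coordinates\<close>

lemma gram_mult_orthogonal:
  fixes P :: "('m::finite, 'm) rmat"
  assumes "orthogonal_matrix P"
  shows "transpose (P ** G) ** (P ** G) = transpose G ** G"
proof -
  have "transpose (P ** G) ** (P ** G) = transpose G ** (transpose P ** P) ** G"
    by (simp add: matrix_transpose_mul matrix_mul_assoc)
  then show ?thesis using assms by (simp add: orthogonal_matrix)
qed

lemma column_inner_orthogonal:
  fixes P :: "('m::finite, 'm) rmat"
  assumes "orthogonal_matrix P"
  shows "column i (P ** G) \<bullet> column j (P ** G) = column i G \<bullet> column j G"
  using gram_mult_orthogonal[OF assms, of G] by (metis gram_entry)

lemma transpose_mult_sandwich:
  "transpose (P ** G) ** M ** (Q ** H) = transpose G ** (transpose P ** M ** Q) ** H"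
  for P :: "('m::finite, 'm) rmat"
  by (simp add: matrix_transpose_mul matrix_mul_assoc)

lemma jac_mat_mult: "jac_mat A (P ** G) (Q ** H) = jac_mat (\<lambda>j. transpose P ** A j ** Q) G H"
  by (simp add: vec_eq_iff jac_mat_entry transpose_mult_sandwich)

lemma resid_mult_orthogonal:
  assumes "orthogonal_matrix P" "orthogonal_matrix Q"
  shows "resid \<sigma> M (P ** G) (Q ** H) = resid \<sigma> (transpose P ** M ** Q) G H"
  by (simp add: vec_eq_iff resid_entry transpose_mult_sandwich gram_mult_orthogonal assms)

text \<open>Besides \<open>W\<close>, the factors enter only through inner products of their
  columns.\<close>

lemma X_corr_mult_orthogonal:
  assumes "orthogonal_matrix P" "orthogonal_matrix Q"
  shows "X_corr \<sigma> W (P ** G) (Q ** H) = X_corr \<sigma> W G H"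
  by (simp add: X_corr_def column_inner_orthogonal assms cong: if_cong)

lemma Y_corr_mult_orthogonal:
  assumes "orthogonal_matrix P" "orthogonal_matrix Q"
  shows "Y_corr \<sigma> W (P ** G) (Q ** H) = Y_corr \<sigma> W G H"
  by (simp add: Y_corr_def column_inner_orthogonal assms cong: if_cong)

lemma affine_mat_sandwich:
  "affine_mat (P ** A0 ** Q) (\<lambda>j. P ** A j ** Q) c = P ** affine_mat A0 A c ** Q"
  for P :: "('k::finite, 'm::finite) rmat" and Q :: "('n::finite, 'n) rmat"
proof -
  have "P ** (\<Sum>i\<in>S. c $ i *\<^sub>R A i) ** Q = (\<Sum>i\<in>S. c $ i *\<^sub>R (P ** A i ** Q))" if "finite S" for S
    using that
  proof (induction S)
    case empty
    show ?case by (simp add: matrix_matrix_mult_def zero_vec_def)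
  next
    case (insert i S)
    then show ?case
      by (simp add: matrix_add_ldistrib matrix_add_rdistrib matrix_scalar_ac scalar_matrix_assoc
        flip: scalar_mult_eq_scaleR)
  qed
  then show ?thesis
    by (simp add: affine_mat_def matrix_add_ldistrib matrix_add_rdistrib)
qed

definition rotate_state :: "('m::finite, 'm) rmat \<Rightarrow> ('n::finite, 'n) rmat
    \<Rightarrow> 'n rvec \<times> ('m, 'm) rmat \<times> ('n, 'n) rmat \<times> ('n, 'n) rmat
    \<Rightarrow> 'n rvec \<times> ('m, 'm) rmat \<times> ('n, 'n) rmat \<times> ('n, 'n) rmat" where
  "rotate_state P Q = (\<lambda>(c, G, H, B). (c, P ** G, Q ** H, B))"

text \<open>The matrices \<open>W\<close>, the Jacobian and the residuals see \<open>P\<close> and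
  \<open>Q\<close> only through the transformed coefficient matrices, and the factors are updated by
  multiplication from the right; hence \<open>P\<close> and \<open>Q\<close> pull out on the
  left.\<close>

lemma cf_step_rotate_state:
  assumes P: "orthogonal_matrix P" and Q: "orthogonal_matrix Q"
  shows "cf_step A0 A \<sigma> (rotate_state P Q s)
    = rotate_state P Q (cf_step (transpose P ** A0 ** Q) (\<lambda>j. transpose P ** A j ** Q) \<sigma> s)"
proof (cases s)
  case (fields c G H B)
  show ?thesis
    unfolding fields rotate_state_def cf_step_def
    by (simp add: Let_def jac_mat_mult resid_mult_orthogonal[OF P Q] X_corr_mult_orthogonal[OF P Q]
      Y_corr_mult_orthogonal[OF P Q] transpose_mult_sandwich affine_mat_sandwich
      flip: matrix_mul_assoc[of P] matrix_mul_assoc[of Q])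
qed

lemma cf_step_funpow_rotate_state:
  assumes "orthogonal_matrix P" and "orthogonal_matrix Q"
  shows "(cf_step A0 A \<sigma> ^^ k) (rotate_state P Q s)
    = rotate_state P Q ((cf_step (transpose P ** A0 ** Q) (\<lambda>j. transpose P ** A j ** Q) \<sigma> ^^ k) s)"
  by (induction k) (simp_all add: cf_step_rotate_state[OF assms])

lemma fst_rotate_state [simp]: "fst (rotate_state P Q s) = fst s"
  by (simp add: rotate_state_def split: prod.split)

section \<open>Existence of singular value decompositions\<close>

lemma unit_orthogonal_exists:
  fixes f :: "'i \<Rightarrow> 'k::finite rvec"
  assumes "finite I" and "card I < CARD('k)"
  shows "\<exists>x. norm x = 1 \<and> (\<forall>i\<in>I. f i \<bullet> x = 0)"
proof -
  have "dim (f ` I) \<le> card I"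
    using dim_le_card'[of "f ` I"] card_image_le[OF assms(1), of f] assms(1) by simp
  then have "dim (f ` I) < DIM('k rvec)" using assms(2) by simp
  then obtain x where x: "x \<noteq> 0" "\<And>y. y \<in> span (f ` I) \<Longrightarrow> orthogonal x y"
    using orthogonal_to_subspace_exists by blast
  have "f i \<bullet> x = 0" if "i \<in> I" for i
    using x(2)[OF span_base, of "f i"] that by (simp add: orthogonal_def inner_commute)
  then show ?thesis
    using x(1) by (intro exI[of _ "(1 / norm x) *\<^sub>R x"]) simp
qed

text \<open>Induction on the number of indices outside \<open>T\<close>. It supplies the left
  singular vectors that are not determined by nonzero singular values.\<close>

lemma orthonormal_extension:
  fixes g :: "'k::finite \<Rightarrow> 'k rvec"
  assumes "\<And>i. i \<in> T \<Longrightarrow> norm (g i) = 1"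
    and "\<And>i j. i \<in> T \<Longrightarrow> j \<in> T \<Longrightarrow> i \<noteq> j \<Longrightarrow> g i \<bullet> g j = 0"
  shows "\<exists>h. (\<forall>i\<in>T. h i = g i) \<and> (\<forall>i. norm (h i) = 1) \<and> (\<forall>i j. i \<noteq> j \<longrightarrow> h i \<bullet> h j = 0)"
  using assms
proof (induction "card (- T)" arbitrary: T g)
  case 0
  then have "- T = {}" by simp
  then have "T = UNIV" by blast
  then show ?case using 0 by blast
next
  case (Suc n)
  then obtain k where k: "k \<notin> T" by (metis Compl_iff card.empty ex_in_conv nat.distinct(1))
  then have "card T < CARD('k)" by (intro psubset_card_mono) auto
  then obtain x where x: "norm x = 1" "\<forall>i\<in>T. g i \<bullet> x = 0"
    using unit_orthogonal_exists[of T g] by auto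
  have "n = card (- insert k T)"
    using Suc.hyps(2) k by (simp add: Compl_insert)
  moreover have "norm ((g(k := x)) i) = 1" if "i \<in> insert k T" for i
    using that x Suc.prems by auto
  moreover have "(g(k := x)) i \<bullet> (g(k := x)) j = 0" if "i \<in> insert k T" "j \<in> insert k T" "i \<noteq> j" for i j
    using that x Suc.prems by (auto simp: inner_commute)
  ultimately obtain h where h: "\<forall>i\<in>insert k T. h i = (g(k := x)) i" "\<forall>i. norm (h i) = 1"
    "\<forall>i j. i \<noteq> j \<longrightarrow> h i \<bullet> h j = 0"
    using Suc.hyps(1)[of "insert k T" "g(k := x)"] by blast
  have "\<forall>i\<in>T. h i = g i" using h(1) k by auto
  then show ?case using h by blast
qed

text \<open>Each vector maximises the stretch over the unit vectors orthogonal to its predecessors.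
  This set is compact, and nonempty because there are fewer predecessors than dimensions.\<close>

lemma greedy_right_singular_vectors:
  fixes M :: "('m::finite, 'n::{finite,linorder}) rmat"
  shows "\<exists>f :: 'n \<Rightarrow> 'n rvec. \<forall>j. norm (f j) = 1 \<and> (\<forall>i<j. f i \<bullet> f j = 0)
    \<and> (\<forall>x. norm x = 1 \<and> (\<forall>i<j. f i \<bullet> x = 0) \<longrightarrow> norm (M *v x) \<le> norm (M *v f j))"
proof (rule dependent_wf_choice)
  have "{(x, y). x < y} \<subseteq> inv_image less_than (\<lambda>i::'n. card {..<i})"
    by (auto intro: card_lessThan_mono)
  then show "wf {(x, y :: 'n). x < y}"
    by (rule wf_subset[OF wf_inv_image[OF wf_less_than]])
next
  \<comment> \<open>The property required at \<open>j\<close> consults the choice function only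
    below \<open>j\<close>.\<close>
  fix f g :: "'n \<Rightarrow> 'n rvec" and j r
  assume "\<And>i. (i, j) \<in> {(x, y). x < y} \<Longrightarrow> f i = g i"
  then show "(norm r = 1 \<and> (\<forall>i<j. f i \<bullet> r = 0)
      \<and> (\<forall>x. norm x = 1 \<and> (\<forall>i<j. f i \<bullet> x = 0) \<longrightarrow> norm (M *v x) \<le> norm (M *v r)))
    = (norm r = 1 \<and> (\<forall>i<j. g i \<bullet> r = 0)
      \<and> (\<forall>x. norm x = 1 \<and> (\<forall>i<j. g i \<bullet> x = 0) \<longrightarrow> norm (M *v x) \<le> norm (M *v r)))"
    by auto
next
  fix f :: "'n \<Rightarrow> 'n rvec" and j
  let ?S = "sphere 0 1 \<inter> (\<Inter>i\<in>{..<j}. {x. f i \<bullet> x = 0})"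
  have cl: "closed {x. f i \<bullet> x = 0}" for i
    by (intro closed_Collect_eq continuous_intros)
  have "compact ?S"
    by (rule compact_Int_closed[OF compact_sphere closed_INT]) (simp add: cl)
  moreover have "?S \<noteq> {}"
    using unit_orthogonal_exists[of "{..<j}" f] card_lessThan_less[of j] by fastforce
  moreover have "continuous_on ?S (\<lambda>x. norm (M *v x))"
    by (intro continuous_intros)
  ultimately have "\<exists>r\<in>?S. \<forall>x\<in>?S. norm (M *v x) \<le> norm (M *v r)"
    by (rule continuous_attains_sup)
  then obtain r where r: "r \<in> ?S" "\<forall>x\<in>?S. norm (M *v x) \<le> norm (M *v r)" ..
  show "\<exists>r. norm r = 1 \<and> (\<forall>i<j. f i \<bullet> r = 0)
      \<and> (\<forall>x. norm x = 1 \<and> (\<forall>i<j. f i \<bullet> x = 0) \<longrightarrow> norm (M *v x) \<le> norm (M *v r))"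
    using r by (intro exI[of _ r]) auto
qed

lemma linear_le_quadratic_imp_zero:
  fixes x y :: real
  assumes "\<And>t. t * x \<le> t\<^sup>2 * y" shows "x = 0"
proof (rule ccontr)
  assume "x \<noteq> 0"
  \<comment> \<open>With this choice \<open>t * x = t^2 * (\<bar>y\<bar> + 1)\<close>, so the
    assumption would force \<open>t^2 \<le> 0\<close>.\<close>
  define t where "t = x / (\<bar>y\<bar> + 1)"
  have "t * x \<le> t\<^sup>2 * \<bar>y\<bar>"
    using assms[of t] by (meson abs_ge_self mult_left_mono order.trans zero_le_power2)
  moreover have "x = t * (\<bar>y\<bar> + 1)" by (simp add: t_def)
  ultimately have "t\<^sup>2 \<le> 0" by (simp add: power2_eq_square algebra_simps)
  then show False using \<open>x = t * (\<bar>y\<bar> + 1)\<close> \<open>x \<noteq> 0\<close> by simp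
qed

text \<open>First-order condition for \<open>a\<close> to maximise the stretch on the plane spanned by \<open>a\<close> and \<open>b\<close>.\<close>

lemma maximal_stretch_orthogonal:
  fixes M :: "('m::finite, 'n::finite) rmat"
  assumes "norm a = 1" "norm b = 1" "a \<bullet> b = 0"
    and max: "\<And>s t. norm (s *\<^sub>R a + t *\<^sub>R b) = 1 \<Longrightarrow> norm (M *v (s *\<^sub>R a + t *\<^sub>R b)) \<le> norm (M *v a)"
  shows "(M *v a) \<bullet> (M *v b) = 0"
proof -
  \<comment> \<open>Maximality applies to the normalised vector \<open>a + t b\<close>, whose
    squared length before normalisation is \<open>1 + t^2\<close>; expanding the squares leaves the
    inner product as the coefficient linear in \<open>t\<close>.\<close>
  have "t * (2 * ((M *v a) \<bullet> (M *v b))) \<le> t\<^sup>2 * ((norm (M *v a))\<^sup>2)" for t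
  proof -
    let ?w = "a + t *\<^sub>R b"
    have w2: "(norm ?w)\<^sup>2 = 1 + t\<^sup>2"
      using assms(1-3) unfolding power2_norm_eq_inner
      by (simp add: inner_add_left inner_add_right norm_eq_1 inner_commute power2_eq_square)
    then have wpos: "0 < norm ?w"
      by (smt (verit) norm_ge_zero power_zero_numeral zero_le_power2 zero_less_norm_iff norm_zero)
    let ?n = "1 / norm ?w"
    have eq: "?n *\<^sub>R a + (?n * t) *\<^sub>R b = ?n *\<^sub>R ?w" by (simp add: scaleR_add_right)
    have "norm (M *v (?n *\<^sub>R ?w)) \<le> norm (M *v a)"
      using max[of ?n "?n * t"] wpos unfolding eq by simp
    moreover have "norm (M *v (?n *\<^sub>R ?w)) = norm (M *v ?w) / norm ?w"
      by (simp only: matrix_vector_mult_scaleR norm_scaleR) simp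
    ultimately have "norm (M *v ?w) \<le> norm (M *v a) * norm ?w"
      using wpos by (simp only: pos_divide_le_eq)
    then have "(norm (M *v ?w))\<^sup>2 \<le> (norm (M *v a) * norm ?w)\<^sup>2"
      by (rule power_mono) simp
    then have "(norm (M *v ?w))\<^sup>2 \<le> (norm (M *v a))\<^sup>2 * (1 + t\<^sup>2)"
      by (simp add: power_mult_distrib w2)
    moreover have "(norm (M *v ?w))\<^sup>2 = (norm (M *v a))\<^sup>2 + 2 * t * ((M *v a) \<bullet> (M *v b)) + t\<^sup>2 * (norm (M *v b))\<^sup>2"
      unfolding power2_norm_eq_inner
      by (simp add: matrix_vector_right_distrib matrix_vector_mult_scaleR inner_add_left inner_add_right
        inner_commute power2_eq_square)
    ultimately have "t * (2 * ((M *v a) \<bullet> (M *v b))) + t\<^sup>2 * (norm (M *v b))\<^sup>2 \<le> t\<^sup>2 * (norm (M *v a))\<^sup>2"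
      by (simp add: algebra_simps)
    moreover have "0 \<le> t\<^sup>2 * (norm (M *v b))\<^sup>2" by simp
    ultimately show ?thesis by linarith
  qed
  then show ?thesis using linear_le_quadratic_imp_zero by fastforce
qed

theorem svd_exists:
  fixes M :: "('m::{finite,linorder}, 'n::{finite,linorder}) rmat"
  assumes card: "CARD('n) \<le> CARD('m)"
  shows "\<exists>U s V. is_svd M U s V"
proof -
  obtain f :: "'n \<Rightarrow> 'n rvec" where f: "\<And>j. norm (f j) = 1" "\<And>i j. i < j \<Longrightarrow> f i \<bullet> f j = 0"
    and max: "\<And>j x. norm x = 1 \<Longrightarrow> (\<And>i. i < j \<Longrightarrow> f i \<bullet> x = 0) \<Longrightarrow> norm (M *v x) \<le> norm (M *v f j)"
    using greedy_right_singular_vectors[of M] by metis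
  have f0: "f i \<bullet> f j = 0" if "i \<noteq> j" for i j
    using that f(2)[of i j] f(2)[of j i] by (auto simp: inner_commute neq_iff)
  \<comment> \<open>A unit combination of \<open>f i\<close> and a later \<open>f j\<close> is still
    orthogonal to everything before \<open>f i\<close>, so it competes in the maximisation defining
    \<open>f i\<close>.\<close>
  have Mf0: "(M *v f i) \<bullet> (M *v f j) = 0" if "i < j" for i j
  proof (rule maximal_stretch_orthogonal)
    fix s t assume "norm (s *\<^sub>R f i + t *\<^sub>R f j) = 1"
    then show "norm (M *v (s *\<^sub>R f i + t *\<^sub>R f j)) \<le> norm (M *v f i)"
      using that by (intro max) (auto simp: inner_add_right f0)
  qed (use f f0 that in auto)
  then have Mf: "(M *v f i) \<bullet> (M *v f j) = 0" if "i \<noteq> j" for i j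
    using that Mf0[of i j] Mf0[of j i] by (auto simp: inner_commute neq_iff)
  define s where "s j = norm (M *v f j)" for j
  \<comment> \<open>Where \<open>s\<close> vanishes the quotient is meaningless, and those indices
    are left to \<open>orthonormal_extension\<close>.\<close>
  define g :: "'m \<Rightarrow> 'm rvec" where "g i = (1 / s (inv emb i)) *\<^sub>R (M *v f (inv emb i))" for i
  have inv: "inv emb (emb j :: 'm) = j" for j :: 'n
    by (rule inv_f_f) (simp add: inj_on_def emb_eq_iff[OF card])
  have "\<exists>h. (\<forall>i\<in>emb ` {j. s j \<noteq> 0}. h i = g i) \<and> (\<forall>i. norm (h i) = 1) \<and> (\<forall>i j. i \<noteq> j \<longrightarrow> h i \<bullet> h j = 0)"
    by (rule orthonormal_extension) (auto simp: g_def inv Mf emb_eq_iff[OF card] s_def)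
  then obtain h where "\<forall>i\<in>emb ` {j. s j \<noteq> 0}. h i = g i" and h2: "\<And>i. norm (h i) = 1"
    "\<And>i j. i \<noteq> j \<Longrightarrow> h i \<bullet> h j = 0" by blast
  then have h1: "h (emb j) = g (emb j)" if "s j \<noteq> 0" for j
    using that by blast
  have Mh: "M *v f j = s j *\<^sub>R h (emb j)" for j
    by (cases "s j = 0") (simp add: s_def, simp add: h1 g_def inv)
  define U :: "('m, 'm) rmat" where "U = (\<chi> i j. h j $ i)"
  define V :: "('n, 'n) rmat" where "V = (\<chi> i j. f j $ i)"
  have col: "column j U = h j" "column k V = f k" for j k
    by (simp_all add: U_def V_def column_def vec_eq_iff)
  have "is_svd M U s V"
    unfolding is_svd_def
  proof (intro conjI allI)
    show "orthogonal_matrix U" "orthogonal_matrix V"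
      using h2 f f0 by (simp_all add: orthogonal_matrix_orthonormal_columns col orthogonal_def)
    show "0 \<le> s j" for j by (simp add: s_def)
    show "antimono s"
    proof (rule antimonoI)
      fix i j :: 'n assume "i \<le> j"
      then show "s j \<le> s i"
        unfolding s_def using f by (intro max) auto
    qed
    have "(transpose U ** M ** V) $ i $ j = (if i = emb j then s j else 0)" for i j
      unfolding column_inner_mult[symmetric] col Mh using h2(1)[of i] h2(2)[of i "emb j"]
      by (auto simp: norm_eq_1)
    then show "transpose U ** M ** V = (\<chi> i j. if i = emb j then s j else 0)"
      by (simp add: vec_eq_iff)
  qed
  then show ?thesis by blast
qed

section \<open>Stability of singular value decompositions\<close>

lemma tendsto_matrix_mult [tendsto_intros]:
  fixes f :: "'a \<Rightarrow> ('m::finite, 'k::finite) rmat" and g :: "'a \<Rightarrow> ('k, 'n::finite) rmat"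
  assumes "(f \<longlongrightarrow> a) F" "(g \<longlongrightarrow> b) F"
  shows "((\<lambda>x. f x ** g x) \<longlongrightarrow> a ** b) F"
  unfolding matrix_matrix_mult_def by (intro tendsto_intros assms)

lemma tendsto_transpose [tendsto_intros]:
  fixes f :: "'a \<Rightarrow> ('m::finite, 'n::finite) rmat"
  assumes "(f \<longlongrightarrow> a) F" shows "((\<lambda>x. transpose (f x)) \<longlongrightarrow> transpose a) F"
  unfolding transpose_def by (intro tendsto_intros assms)


section \<open>Singular pairs and uniqueness of singular values\<close>

lemma column_matrix_mult: "column j (N ** L) = N *v column j L"
  by (simp add: column_def matrix_matrix_mult_def matrix_vector_mult_def)

lemma svd_pair:
  fixes M :: "('m::{finite,linorder}, 'n::{finite,linorder}) rmat"
  assumes card: "CARD('n) \<le> CARD('m)" and svd: "is_svd M U s V"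
  shows "M *v column j V = s j *\<^sub>R column (emb j) U"
    and "transpose M *v column (emb j) U = s j *\<^sub>R column j V"
proof -
  have U: "orthogonal_matrix U" and V: "orthogonal_matrix V"
    and S: "transpose U ** M ** V = rect_diag s"
    using svd by (auto simp: is_svd_def rect_diag_def)
  have MV: "M ** V = U ** rect_diag s"
    using U by (simp add: S[symmetric] matrix_mul_assoc) (simp add: orthogonal_matrix_def)
  have "transpose U ** M = rect_diag s ** transpose V"
    using V by (simp add: S[symmetric] matrix_mul_assoc[symmetric]) (simp add: orthogonal_matrix_def)
  then have MU: "transpose M ** U = V ** transpose (rect_diag s)"
    by (metis matrix_transpose_mul transpose_transpose)
  have "M *v column j V = U *v column j (rect_diag s)"
    by (simp only: column_matrix_mult[symmetric] MV)
  also have "\<dots> = s j *\<^sub>R column (emb j) U"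
    by (simp add: vec_eq_iff matrix_vector_mult_def column_def rect_diag_def
      if_distrib[of "\<lambda>y. _ * y"] cong: if_cong)
  finally show "M *v column j V = s j *\<^sub>R column (emb j) U" .
  have "transpose M *v column (emb j) U = V *v column (emb j) (transpose (rect_diag s :: ('m, 'n) rmat))"
    by (simp only: column_matrix_mult[symmetric] MU)
  also have "\<dots> = s j *\<^sub>R column j V"
    by (simp add: vec_eq_iff matrix_vector_mult_def column_def rect_diag_def transpose_def
      emb_eq_iff[OF card] if_distrib[of "\<lambda>y. _ * y"] cong: if_cong)
  finally show "transpose M *v column (emb j) U = s j *\<^sub>R column j V" .
qed

lemma svd_unit_singular_pair:
  fixes M :: "('m::{finite,linorder}, 'n::{finite,linorder}) rmat"
  assumes "CARD('n) \<le> CARD('m)" and "is_svd M U s V"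
  shows "unit_singular_pair M (s j) (column (emb j) U) (column j V)"
  using svd_pair[OF assms] assms(2)
  by (simp add: unit_singular_pair_def is_svd_def orthogonal_matrix_orthonormal_columns)

text \<open>The inner products \<open>y\<close>, \<open>z\<close> of the right and left vectors
  satisfy \<open>t z = s y\<close> and \<open>t y = s z\<close>, hence \<open>t^2 y = s^2 y\<close>
  with \<open>y\<close> nonzero.\<close>

lemma singular_value_eq:
  fixes M :: "('m::{finite,linorder}, 'n::{finite,linorder}) rmat"
  assumes card: "CARD('n) \<le> CARD('m)" and svd: "is_svd M U s V"
    and pair: "unit_singular_pair M t u v" and "0 < t" and nz: "column j V \<bullet> v \<noteq> 0"
  shows "s j = t"
proof -
  let ?y = "column j V \<bullet> v" and ?z = "column (emb j) U \<bullet> u"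
  have "t * ?z = column (emb j) U \<bullet> (M *v v)"
    using pair by (simp add: unit_singular_pair_def)
  also have "\<dots> = (transpose M *v column (emb j) U) \<bullet> v"
    by (simp add: dot_lmul_matrix)
  also have "\<dots> = s j * ?y"
    by (simp only: svd_pair(2)[OF card svd] inner_scaleR_left)
  finally have 1: "t * ?z = s j * ?y" .
  have "t * ?y = column j V \<bullet> (transpose M *v u)"
    using pair by (simp add: unit_singular_pair_def)
  also have "\<dots> = (M *v column j V) \<bullet> u"
    by (metis dot_lmul_matrix inner_commute transpose_matrix_vector)
  also have "\<dots> = s j * ?z"
    by (simp add: svd_pair(1)[OF card svd])
  finally have 2: "t * ?y = s j * ?z" .
  have "t\<^sup>2 * ?y = (s j)\<^sup>2 * ?y"
    using 1 2 by (simp add: power2_eq_square mult.assoc)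
  then have "t\<^sup>2 = (s j)\<^sup>2" using nz by simp
  moreover have "0 \<le> s j" using svd by (simp add: is_svd_def)
  ultimately show ?thesis using \<open>0 < t\<close> by (metis less_eq_real_def power2_eq_imp_eq)
qed

lemma orthogonal_matrix_expansion:
  fixes V :: "('n::finite, 'n) rmat"
  assumes "orthogonal_matrix V"
  shows "v = (\<Sum>j\<in>UNIV. (column j V \<bullet> v) *\<^sub>R column j V)"
proof -
  have "v = V *v (transpose V *v v)"
    using assms by (simp add: matrix_vector_mul_assoc orthogonal_matrix_def del: transpose_matrix_vector)
  also have "\<dots> = (\<Sum>j\<in>UNIV. (column j V \<bullet> v) *\<^sub>R column j V)"
    by (simp add: matrix_mult_sum transpose_def matrix_vector_mult_def column_def inner_vec_def
      scalar_mult_eq_scaleR mult.commute)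
  finally show ?thesis .
qed

text \<open>Injectivity forbids the set below, or the set above, a point from being mapped into a
  smaller one; moving the point would shrink one of the two.\<close>

lemma strict_mono_self_finite:
  fixes p :: "'n::{finite,linorder} \<Rightarrow> 'n"
  assumes "strict_mono p" shows "p i = i"
proof (rule ccontr)
  have inj: "inj_on p S" for S
    by (rule inj_onI) (simp add: strict_mono_eq[OF assms])
  have "card {..<i} \<le> card {..<p i}" "card {i<..} \<le> card {p i<..}"
    using assms by (auto intro!: card_inj_on_le[OF inj] simp: strict_mono_less)
  moreover assume "p i \<noteq> i"
  then have "p i < i \<or> i < p i" by auto
  then have "card {..<p i} < card {..<i} \<or> card {p i<..} < card {i<..}"
    by (auto intro!: psubset_card_mono)
  ultimately show False by linarith
qed

text \<open>Every \<open>\<sigma> i\<close> occurs in \<open>s\<close>, since its right singular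
  vector has a nonzero coefficient in the basis \<open>V'\<close>. The positions of occurrence
  increase strictly with \<open>i\<close>, hence are the identity.\<close>

lemma singular_values_unique:
  fixes M :: "('m::{finite,linorder}, 'n::{finite,linorder}) rmat"
  assumes card: "CARD('n) \<le> CARD('m)" and svd: "is_svd M U \<sigma> V" and svd': "is_svd M U' s V'"
    and dec: "\<And>i j. i < j \<Longrightarrow> \<sigma> j < \<sigma> i" and pos: "\<And>i. 0 < \<sigma> i"
  shows "s = \<sigma>"
proof -
  have "\<exists>j. s j = \<sigma> i" for i
  proof -
    have V': "orthogonal_matrix V'" using svd' by (simp add: is_svd_def)
    have pair: "unit_singular_pair M (\<sigma> i) (column (emb i) U) (column i V)"
      by (rule svd_unit_singular_pair[OF card svd])
    then have "column i V \<noteq> 0" by (auto simp: unit_singular_pair_def)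
    then obtain j where "column j V' \<bullet> column i V \<noteq> 0"
      using orthogonal_matrix_expansion[OF V', of "column i V"] by force
    then show ?thesis using singular_value_eq[OF card svd' pair pos] by blast
  qed
  then obtain p where p: "\<And>i. s (p i) = \<sigma> i" by metis
  have "strict_mono p"
  proof (rule strict_monoI)
    fix i j :: 'n assume "i < j"
    then have "s (p j) < s (p i)" using dec p by simp
    moreover have "antimono s" using svd' by (simp add: is_svd_def)
    ultimately show "p i < p j"
      using antimonoD[of s "p j" "p i"] by (cases "p i < p j") (auto simp: not_less)
  qed
  then have "s i = \<sigma> i" for i
    using p[of i] strict_mono_self_finite[of p i] by simp
  then show ?thesis by (rule ext)
qed

text \<open>A simple positive singular value determines its pair of unit vectors up to one common
  sign \<open>y\<close>, and \<open>y * y = 1\<close> drops out of the bilinear form.\<close>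

lemma jac_singular_pairs_eq:
  fixes A :: "'n::{finite,linorder} \<Rightarrow> ('m::{finite,linorder}, 'n) rmat"
  assumes card: "CARD('n) \<le> CARD('m)" and svd: "is_svd M U \<sigma> V"
    and inj: "\<And>i j. i \<noteq> j \<Longrightarrow> \<sigma> i \<noteq> \<sigma> j" and pos: "\<And>i. 0 < \<sigma> i"
    and pair: "\<And>i. unit_singular_pair M (\<sigma> i) (u i) (v i)"
  shows "jac A u v = jac_mat A U V"
proof -
  have V: "orthogonal_matrix V" using svd by (simp add: is_svd_def)
  have "u i \<bullet> (N *v v i) = column (emb i) U \<bullet> (N *v column i V)" for i and N :: "('m, 'n) rmat"
  proof -
    define y where "y = column i V \<bullet> v i"
    have "column j V \<bullet> v i = 0" if "j \<noteq> i" for j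
      using singular_value_eq[OF card svd pair[of i] pos] inj[OF that] by blast
    then have "(\<Sum>j\<in>UNIV. (column j V \<bullet> v i) *\<^sub>R column j V)
        = (\<Sum>j\<in>UNIV. if j = i then y *\<^sub>R column i V else 0)"
      by (intro sum.cong) (auto simp: y_def)
    then have v: "v i = y *\<^sub>R column i V"
      using orthogonal_matrix_expansion[OF V, of "v i"] by simp
    have "norm (column i V) = 1" "norm (v i) = 1"
      using svd_unit_singular_pair[OF card svd, of i] pair[of i] by (simp_all add: unit_singular_pair_def)
    then have y: "y * y = 1"
      unfolding v by (auto simp: abs_if split: if_splits)
    have "\<sigma> i *\<^sub>R u i = M *v v i"
      using pair by (simp add: unit_singular_pair_def)
    also have "\<dots> = y *\<^sub>R (M *v column i V)"
      by (simp only: v matrix_vector_mult_scaleR)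
    also have "\<dots> = \<sigma> i *\<^sub>R (y *\<^sub>R column (emb i) U)"
      by (simp add: svd_pair(1)[OF card svd])
    finally have u: "u i = y *\<^sub>R column (emb i) U"
      by (rule real_vector.scale_left_imp_eq[rotated]) (use pos[of i] in simp)
    have "u i \<bullet> (N *v v i) = (y *\<^sub>R column (emb i) U) \<bullet> (N *v (y *\<^sub>R column i V))"
      by (simp only: u v)
    also have "\<dots> = (y * y) * (column (emb i) U \<bullet> (N *v column i V))"
      by (simp add: matrix_vector_mult_scaleR)
    finally show ?thesis by (simp add: y)
  qed
  then show ?thesis by (simp add: jac_mat_def jac_def vec_eq_iff)
qed

section \<open>Frobenius norms of products\<close>

lemma norm_transpose: "norm (transpose M) = norm M" for M :: "('m::finite, 'n::finite) rmat"
proof (rule power2_eq_imp_eq)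
  show "(norm (transpose M))\<^sup>2 = (norm M)\<^sup>2"
    by (simp only: norm_matrix_sqr transpose_transpose trace_mul_sym[of M])
qed simp_all

lemma norm_orthogonal_mult_right:
  fixes M :: "('m::finite, 'n::finite) rmat"
  assumes "orthogonal_matrix Q" shows "norm (M ** Q) = norm M"
proof -
  have "M ** Q ** transpose (M ** Q) = M ** (Q ** transpose Q) ** transpose M"
    by (simp add: matrix_transpose_mul matrix_mul_assoc)
  then have "(norm (M ** Q))\<^sup>2 = (norm M)\<^sup>2"
    using assms by (simp add: norm_matrix_sqr orthogonal_matrix_def)
  then show ?thesis by (simp add: power2_eq_iff_nonneg)
qed

lemma norm_orthogonal_mult_left:
  fixes M :: "('m::finite, 'n::finite) rmat"
  assumes "orthogonal_matrix P" shows "norm (P ** M) = norm M"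
  by (metis assms matrix_transpose_mul norm_orthogonal_mult_right norm_transpose orthogonal_matrix_transpose)

lemma norm_matrix_mult_le: "norm (M ** N) \<le> norm M * norm N"
  for M :: "('m::finite, 'k::finite) rmat" and N :: "('k, 'n::finite) rmat"
proof -
  have row: "norm ((M ** N) $ i) \<le> norm (M $ i) * norm N" for i
  proof -
    have "(M ** N) $ i = (\<Sum>k\<in>UNIV. M $ i $ k *\<^sub>R N $ k)"
      by (simp add: vec_eq_iff matrix_matrix_mult_def)
    then have "norm ((M ** N) $ i) \<le> (\<Sum>k\<in>UNIV. \<bar>M $ i $ k\<bar> * \<bar>norm (N $ k)\<bar>)"
      by (simp add: sum_norm_le)
    also have "\<dots> \<le> L2_set (\<lambda>k. M $ i $ k) UNIV * L2_set (\<lambda>k. norm (N $ k)) UNIV"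
      by (rule L2_set_mult_ineq)
    finally show ?thesis by (simp add: norm_vec_def L2_set_def)
  qed
  have "norm (M ** N) \<le> L2_set (\<lambda>i. norm (M $ i) * norm N) UNIV"
    unfolding norm_vec_def[of "M ** N"] by (rule L2_set_mono[OF row]) simp
  also have "\<dots> = norm M * norm N"
    by (simp add: L2_set_left_distrib[symmetric] norm_vec_def[of M])
  finally show ?thesis .
qed

text \<open>By compactness: along a sequence of counterexamples tending to \<open>M\<close> the
  orthogonal factors have convergent subsequences, their limits decompose \<open>M\<close>, and the
  limiting values are \<open>\<sigma>\<close> by uniqueness. The nearby decomposition depends on the
  given one, as trailing left vectors may rotate and signs may change.\<close>

lemma svd_near:
  fixes M :: "('m::{finite,linorder}, 'n::{finite,linorder}) rmat"
  assumes card: "CARD('n) \<le> CARD('m)" and sv: "singular_values M \<sigma>"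
    and dec: "\<And>i j. i < j \<Longrightarrow> \<sigma> j < \<sigma> i" and pos: "\<And>i. 0 < \<sigma> i" and "0 < \<epsilon>"
  shows "\<exists>\<delta>>0. \<forall>N U s V. norm (N - M) < \<delta> \<and> is_svd N U s V
    \<longrightarrow> (\<exists>U' V'. is_svd M U' \<sigma> V' \<and> norm (U - U') < \<epsilon> \<and> norm (V - V') < \<epsilon>)"
proof (rule ccontr)
  assume "\<not> ?thesis"
  then have "\<exists>N U s V. norm (N - M) < 1 / Suc k \<and> is_svd N U s V
    \<and> \<not> (\<exists>U' V'. is_svd M U' \<sigma> V' \<and> norm (U - U') < \<epsilon> \<and> norm (V - V') < \<epsilon>)" for k
    by (metis of_nat_0_less_iff zero_less_Suc zero_less_divide_1_iff)
  then obtain N U s V where N: "\<And>k. norm (N k - M) < 1 / Suc k"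
    and svd: "\<And>k. is_svd (N k) (U k) (s k) (V k)"
    and far: "\<And>k U' V'. is_svd M U' \<sigma> V' \<Longrightarrow> norm (U k - U') < \<epsilon> \<Longrightarrow> \<not> norm (V k - V') < \<epsilon>"
    by metis
  have "(\<lambda>k. N k - M) \<longlonglongrightarrow> 0"
    using N by (intro Lim_null_comparison[OF _ LIMSEQ_inverse_real_of_nat])
      (auto simp: inverse_eq_divide intro!: always_eventually less_imp_le)
  then have N_lim: "N \<longlonglongrightarrow> M" by (simp add: LIM_zero_iff)
  have "norm (U k) \<le> norm (mat 1 :: ('m, 'm) rmat)" "norm (V k) \<le> norm (mat 1 :: ('n, 'n) rmat)" for k
    using svd[of k] norm_orthogonal_mult_left[of "U k" "mat 1"] norm_orthogonal_mult_left[of "V k" "mat 1"]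
    by (simp_all add: is_svd_def)
  then have "(U k, V k) \<in> cball (0 :: ('m, 'm) rmat) (norm (mat 1 :: ('m, 'm) rmat)) \<times> cball (0 :: ('n, 'n) rmat) (norm (mat 1 :: ('n, 'n) rmat))" for k
    by simp
  moreover have "seq_compact (cball (0 :: ('m, 'm) rmat) (norm (mat 1 :: ('m, 'm) rmat)) \<times> cball (0 :: ('n, 'n) rmat) (norm (mat 1 :: ('n, 'n) rmat)))"
    by (intro compact_imp_seq_compact compact_Times compact_cball)
  ultimately obtain W r where r: "strict_mono r" "((\<lambda>k. (U k, V k)) \<circ> r) \<longlonglongrightarrow> W"
    by (meson seq_compactE)
  obtain U' V' where W: "W = (U', V')" by (cases W)
  have U_lim: "(\<lambda>k. U (r k)) \<longlonglongrightarrow> U'" and V_lim: "(\<lambda>k. V (r k)) \<longlonglongrightarrow> V'"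
    using tendsto_fst[OF r(2)] tendsto_snd[OF r(2)] by (simp_all add: W o_def)
  have Nr_lim: "(\<lambda>k. N (r k)) \<longlonglongrightarrow> M"
    using LIMSEQ_subseq_LIMSEQ[OF N_lim r(1)] by (simp add: o_def)
  have "(\<lambda>k. transpose (U (r k)) ** U (r k)) \<longlonglongrightarrow> transpose U' ** U'"
    "(\<lambda>k. transpose (V (r k)) ** V (r k)) \<longlonglongrightarrow> transpose V' ** V'"
    by (intro tendsto_intros U_lim V_lim)+
  moreover have "transpose (U k) ** U k = mat 1" "transpose (V k) ** V k = mat 1" for k
    using svd[of k] by (simp_all add: is_svd_def orthogonal_matrix)
  ultimately have orth: "orthogonal_matrix U'" "orthogonal_matrix V'"
    by (simp_all add: orthogonal_matrix LIMSEQ_const_iff)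
  define L where "L = transpose U' ** M ** V'"
  have "(\<lambda>k. transpose (U (r k)) ** N (r k) ** V (r k)) \<longlonglongrightarrow> L"
    unfolding L_def by (intro tendsto_intros U_lim V_lim Nr_lim)
  then have "(\<lambda>k. (transpose (U (r k)) ** N (r k) ** V (r k)) $ i $ j) \<longlonglongrightarrow> L $ i $ j" for i j
    by (intro tendsto_vec_nth)
  then have entry: "(\<lambda>k. if i = emb j then s (r k) j else 0) \<longlonglongrightarrow> L $ i $ j" for i j
    using svd by (simp add: is_svd_def)
  define t where "t j = L $ emb j $ j" for j
  have s_lim: "(\<lambda>k. s (r k) j) \<longlonglongrightarrow> t j" for j
    using entry[of "emb j" j] by (simp add: t_def)
  have "L $ i $ j = (if i = emb j then t j else 0)" for i j
    using entry[of i j] by (cases "i = emb j") (simp_all add: t_def LIMSEQ_const_iff)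
  then have "L = (\<chi> i j. if i = emb j then t j else 0)"
    by (simp add: vec_eq_iff)
  moreover have "0 \<le> t j" for j
    using svd by (intro LIMSEQ_le_const[OF s_lim]) (auto simp: is_svd_def)
  moreover have "antimono t"
  proof (rule antimonoI)
    fix i j :: 'n assume "i \<le> j"
    then show "t j \<le> t i"
      using svd by (intro LIMSEQ_le[OF s_lim s_lim]) (auto simp: is_svd_def antimono_def)
  qed
  ultimately have t: "is_svd M U' t V'"
    using orth by (simp add: is_svd_def L_def)
  obtain P Q where "is_svd M P \<sigma> Q"
    using sv by (auto simp: singular_values_def)
  from singular_values_unique[OF card this t dec pos] t have svd': "is_svd M U' \<sigma> V'"
    by simp
  have "eventually (\<lambda>k. norm (U (r k) - U') < \<epsilon>) sequentially"
    "eventually (\<lambda>k. norm (V (r k) - V') < \<epsilon>) sequentially"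
    using tendstoD[OF U_lim \<open>0 < \<epsilon>\<close>] tendstoD[OF V_lim \<open>0 < \<epsilon>\<close>] by (simp_all add: dist_norm)
  then have "eventually (\<lambda>k. False) sequentially"
    by eventually_elim (use far[OF svd'] in blast)
  then show False by simp
qed

section \<open>Estimates for the starting error\<close>

lemma perturbed_inverse_near:
  fixes B J K L :: "('n::finite, 'n) rmat"
  assumes K: "K ** L = mat 1" and "norm K \<le> \<kappa>" and "2 * \<kappa> * norm (J - L) \<le> 1"
  shows "norm (B - K) \<le> 2 * \<kappa> * norm (mat 1 - B ** J) + 2 * \<kappa>\<^sup>2 * norm (J - L)"
proof -
  let ?S = "mat 1 - B ** J" and ?D = "J - L"
  have \<kappa>: "0 \<le> \<kappa>" by (rule order.trans[OF norm_ge_zero assms(2)])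
  have "L ** K = mat 1" using K by (simp add: matrix_left_right_inverse)
  \<comment> \<open>The bracket collapses to \<open>I - B L\<close>, and
    \<open>L K = I\<close>.\<close>
  then have "B - K = - ((?S + (B - K) ** ?D + K ** ?D) ** K)"
    by (simp add: matrix_diff_ldistrib matrix_diff_rdistrib matrix_add_rdistrib K flip: matrix_mul_assoc)
  then have "norm (B - K) = norm ((?S + (B - K) ** ?D + K ** ?D) ** K)"
    by (metis norm_minus_cancel)
  also have "\<dots> \<le> norm (?S + (B - K) ** ?D + K ** ?D) * norm K"
    by (rule norm_matrix_mult_le)
  also have "\<dots> \<le> norm (?S + (B - K) ** ?D + K ** ?D) * \<kappa>"
    by (intro mult_left_mono assms) simp
  also have "\<dots> \<le> (norm ?S + norm (B - K) * norm ?D + norm K * norm ?D) * \<kappa>"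
    using \<kappa> by (intro mult_right_mono norm_triangle_le add_mono norm_matrix_mult_le order_refl)
  also have "\<dots> \<le> (norm ?S + norm (B - K) * norm ?D + \<kappa> * norm ?D) * \<kappa>"
    using assms(2) \<kappa> by (intro mult_right_mono add_left_mono) auto
  also have "\<dots> = \<kappa> * norm ?S + norm (B - K) * (\<kappa> * norm ?D) + \<kappa>\<^sup>2 * norm ?D"
    by (simp add: algebra_simps power2_eq_square)
  also have "\<dots> \<le> \<kappa> * norm ?S + norm (B - K) * (1 / 2) + \<kappa>\<^sup>2 * norm ?D"
    using assms(3) by (intro add_mono mult_left_mono order_refl) auto
  \<comment> \<open>Half of \<open>norm (B - K)\<close> is absorbed into the left side, which
    doubles the other terms.\<close>
  finally show ?thesis by simp
qed

text \<open>Together with \<open>norm_matrix_le_entries\<close> this passes from the spectral norm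
  in the hypothesis on the start to the Frobenius norm used in the estimates.\<close>

lemma entry_le_spectral_norm: "\<bar>M $ i $ j\<bar> \<le> spectral_norm M"
  for M :: "('m::finite, 'n::finite) rmat"
proof -
  have "\<bar>M $ i $ j\<bar> = \<bar>(M *v axis j 1) $ i\<bar>"
    by (simp add: matrix_vector_mult_basis column_def)
  also have "\<dots> \<le> norm (M *v axis j 1)"
    by (rule component_le_norm_cart)
  also have "\<dots> \<le> onorm ((*v) M) * norm (axis j 1 :: 'n rvec)"
    by (intro onorm matrix_vector_mul_bounded_linear)
  finally show ?thesis by (simp add: spectral_norm_def)
qed

lemma norm_matrix_le_entries:
  fixes M :: "('m::finite, 'n::finite) rmat" and b :: real
  assumes "\<And>i j. \<bar>M $ i $ j\<bar> \<le> b"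
  shows "norm M \<le> real CARD('m) * real CARD('n) * b"
proof -
  have "norm M \<le> (\<Sum>i\<in>(UNIV :: 'm set). \<Sum>j\<in>(UNIV :: 'n set). b)"
    by (rule order.trans[OF norm_le_sum_entries]) (intro sum_mono assms)
  then show ?thesis by simp
qed

lemma jac_mat_lipschitz:
  fixes A :: "'n::{finite,linorder} \<Rightarrow> ('m::{finite,linorder}, 'n) rmat" and \<beta> \<epsilon> :: real
  assumes "orthogonal_matrix V" "orthogonal_matrix U'" and "\<And>j. norm (A j) \<le> \<beta>"
    and "norm (U - U') \<le> \<epsilon>" "norm (V - V') \<le> \<epsilon>"
  shows "norm (jac_mat A U V - jac_mat A U' V') \<le> real CARD('n) * real CARD('n) * (2 * \<beta> * \<epsilon>)"
proof (rule norm_matrix_le_entries)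
  fix i j
  have "\<beta> \<ge> 0" using assms(3)[of j] norm_ge_zero order.trans by blast
  have "(jac_mat A U V - jac_mat A U' V') $ i $ j
      = (transpose (U - U') ** A j ** V) $ emb i $ i + (transpose U' ** (A j ** (V - V'))) $ emb i $ i"
    by (simp add: jac_mat_entry transpose_diff matrix_diff_ldistrib matrix_diff_rdistrib matrix_mul_assoc)
  also have "\<bar>\<dots>\<bar> \<le> norm (transpose (U - U') ** A j ** V) + norm (transpose U' ** (A j ** (V - V')))"
    by (intro order.trans[OF abs_triangle_ineq] add_mono matrix_entry_le_norm)
  also have "\<dots> = norm (transpose (U - U') ** A j) + norm (A j ** (V - V'))"
    using assms(1,2) by (simp add: norm_orthogonal_mult_right norm_orthogonal_mult_left)
  also have "\<dots> \<le> norm (transpose (U - U')) * norm (A j) + norm (A j) * norm (V - V')"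
    by (intro add_mono norm_matrix_mult_le)
  also have "\<dots> \<le> \<epsilon> * \<beta> + \<beta> * \<epsilon>"
    using assms \<open>\<beta> \<ge> 0\<close> unfolding norm_transpose
    by (intro add_mono mult_mono) (auto intro: order.trans[OF norm_ge_zero])
  finally show "\<bar>(jac_mat A U V - jac_mat A U' V') $ i $ j\<bar> \<le> 2 * \<beta> * \<epsilon>" by simp
qed

lemma norm_matrix_mono_entries:
  fixes M N :: "('m::finite, 'n::finite) rmat"
  assumes "\<And>i j. \<bar>M $ i $ j\<bar> \<le> \<bar>N $ i $ j\<bar>"
  shows "norm M \<le> norm N"
proof -
  have "norm (M $ i) \<le> norm (N $ i)" for i
    by (rule norm_le_componentwise_cart) (simp add: assms)
  then show ?thesis
    unfolding norm_vec_def[of M] norm_vec_def[of N] by (intro L2_set_mono) simp_all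
qed

text \<open>The Gram term vanishes because the starting factor is orthogonal, and multiplication by
  \<open>U'\<close> or \<open>V'\<close> preserves the Frobenius norm.\<close>

lemma cf_error_initial:
  fixes U U' :: "('m::{finite,linorder}, 'm) rmat" and V V' :: "('n::{finite,linorder}, 'n) rmat"
  assumes "orthogonal_matrix U" "orthogonal_matrix U'" "orthogonal_matrix V'"
  shows "cf_error K cs (c, transpose U' ** U, transpose V' ** V, B)
    \<le> norm (c - cs) + norm (U - U') + norm (V - V') + norm (B - K)"
proof -
  have d: "norm (transpose P ** N - mat 1) = norm (N - P)" if "orthogonal_matrix P"
    for P N :: "('k::finite, 'k) rmat"
  proof -
    have "transpose P ** N - mat 1 = transpose P ** (N - P)"
      using that by (simp add: matrix_diff_ldistrib orthogonal_matrix_def)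
    then show ?thesis using that by (simp add: norm_orthogonal_mult_left)
  qed
  have "norm ((\<chi> i j. if i \<in> range (emb :: 'n \<Rightarrow> 'm) \<or> j \<in> range (emb :: 'n \<Rightarrow> 'm)
      then (transpose U' ** U - mat 1) $ i $ j else 0) :: ('m, 'm) rmat) \<le> norm (transpose U' ** U - mat 1)"
    by (rule norm_matrix_mono_entries) simp
  moreover have "transpose (transpose U' ** U) ** (transpose U' ** U) = transpose U ** U"
    by (rule gram_mult_orthogonal) (simp add: assms)
  then have "transpose (transpose U' ** U) ** (transpose U' ** U) - mat 1 = 0"
    using assms by (simp add: orthogonal_matrix)
  ultimately show ?thesis
    unfolding cf_error_def prod.case by (simp add: d assms)
qed

text \<open>For \<open>1 \<le> p < 3\<close> the exponent \<open>3^k\<close> outgrows both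
  \<open>k\<close> and \<open>p^k\<close>, so the root factor is 0 and no such \<open>p\<close> can
  enter the infimum.\<close>

lemma root_rate_ge_3:
  fixes x :: "nat \<Rightarrow> 'a::real_normed_vector"
  assumes bound: "\<And>k. norm (x k - l) \<le> D * (1/2) ^ (3 ^ k)"
  shows "3 \<le> root_rate x l"
proof -
  have zero: "root_factor p x l = 0" if p: "1 \<le> p" "p < 3" for p
  proof -
    define a where "a k = (if p = 1 then real k else p ^ k)" for k
    have a1: "1 \<le> a k" if "1 \<le> k" for k
      using that p by (simp add: a_def)
    have lim: "filterlim (\<lambda>k. 3 ^ k / a k) at_top sequentially"
    proof (cases "p = 1")
      case True
      have "filterlim (\<lambda>k. 3 ^ k / real k) at_top sequentially" by real_asymp
      then show ?thesis by (simp add: a_def True)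
    next
      case False
      define b where "b = 3 / p"
      have "1 < b" using p by (simp add: b_def)
      then have "filterlim (\<lambda>k. b ^ k) at_top sequentially" by real_asymp
      then show ?thesis using False by (simp add: a_def b_def power_divide)
    qed
    have "((\<lambda>y. (1/2::real) powr y) \<longlongrightarrow> 0) at_top" by real_asymp
    then have "(\<lambda>k. (1/2::real) powr (3 ^ k / a k)) \<longlonglongrightarrow> 0"
      by (rule filterlim_compose[OF _ lim])
    \<comment> \<open>Enlarging \<open>D\<close> to at least 1 bounds its powers with exponent at
      most 1 by itself.\<close>
    then have up: "(\<lambda>k. max D 1 * (1/2) powr (3 ^ k / a k)) \<longlonglongrightarrow> 0"
      by (rule tendsto_mult_right_zero)
    have "norm (x k - l) powr (1 / a k) \<le> max D 1 * (1/2) powr (3 ^ k / a k)" if "1 \<le> k" for k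
    proof -
      have "norm (x k - l) \<le> max D 1 * (1/2) ^ (3 ^ k)"
        by (rule order.trans[OF bound]) (rule mult_right_mono; simp)
      then have "norm (x k - l) powr (1 / a k) \<le> (max D 1 * (1/2) ^ (3 ^ k)) powr (1 / a k)"
        using a1[OF that] by (intro powr_mono2) auto
      also have "\<dots> = max D 1 powr (1 / a k) * ((1/2) ^ (3 ^ k)) powr (1 / a k)"
        by (rule powr_mult)
      also have "((1/2::real) ^ (3 ^ k)) powr (1 / a k) = (1/2) powr (3 ^ k / a k)"
        by (subst powr_realpow[symmetric]) (simp_all add: powr_powr)
      also have "max D 1 powr (1 / a k) \<le> max D 1 powr 1"
        using a1[OF that] by (intro powr_mono) auto
      finally show ?thesis by (simp add: mult_right_mono)
    qed
    then have "(\<lambda>k. norm (x k - l) powr (1 / a k)) \<longlonglongrightarrow> 0"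
      by (intro tendsto_sandwich[OF _ _ tendsto_const up] eventually_sequentiallyI[of 1]) auto
    then have "(\<lambda>k. ereal (norm (x k - l) powr (1 / a k))) \<longlonglongrightarrow> ereal 0"
      by simp
    from lim_imp_Limsup[OF sequentially_bot this] show ?thesis by (simp add: root_factor_def a_def zero_ereal_def)
  qed
  have "3 \<le> Inf (ereal ` {p. 1 \<le> p \<and> root_factor p x l = 1})"
  proof (rule Inf_greatest)
    fix y assume "y \<in> ereal ` {p. 1 \<le> p \<and> root_factor p x l = 1}"
    then obtain p where "y = ereal p" "1 \<le> p" "root_factor p x l = 1" by auto
    then show "3 \<le> y" using zero[of p] by (cases "p < 3") auto
  qed
  then show ?thesis by (simp add: root_rate_def)
qed

section \<open>Local cubic convergence\<close>

lemma affine_mat_tendsto: "(affine_mat A0 A \<longlongrightarrow> affine_mat A0 A cs) (at cs)"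
  unfolding affine_mat_def by (intro tendsto_intros)

lemma initial_error_small:
  fixes A0 :: "('m::{finite,linorder}, 'n::{finite,linorder}) rmat"
  assumes card: "CARD('n) \<le> CARD('m)"
    and dec: "\<And>i j. i < j \<Longrightarrow> \<sigma> j < \<sigma> i" and pos: "\<And>i. 0 < \<sigma> i"
    and sv: "singular_values (affine_mat A0 A cs) \<sigma>"
    and jac: "\<And>U V. is_svd (affine_mat A0 A cs) U \<sigma> V \<Longrightarrow> jac_mat A U V = L"
    and K: "K ** L = mat 1" and "0 < \<eta>"
  shows "\<exists>r>0. \<exists>\<mu>>0. \<forall>c U V B. norm (c - cs) < r \<and> cf_init A0 A c U V
      \<and> spectral_norm (mat 1 - B ** jac_mat A U V) \<le> \<mu>
    \<longrightarrow> (\<exists>U' V'. is_svd (affine_mat A0 A cs) U' \<sigma> V'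
      \<and> cf_error K cs (c, transpose U' ** U, transpose V' ** V, B) \<le> \<eta>)"
proof -
  define \<kappa> where "\<kappa> = norm K + 1"
  define \<beta> where "\<beta> = (\<Sum>j\<in>UNIV. norm (A j)) + 1"
  define N where "N = real CARD('n) * real CARD('n)"
  have \<kappa>: "1 \<le> \<kappa>" "norm K \<le> \<kappa>" by (simp_all add: \<kappa>_def)
  have "norm (A j) \<le> (\<Sum>j\<in>UNIV. norm (A j))" for j
    by (rule member_le_sum) auto
  then have A_le: "norm (A j) \<le> \<beta>" for j
    by (simp add: \<beta>_def add_increasing2)
  have \<beta>: "0 < \<beta>" by (simp add: \<beta>_def sum_nonneg add_nonneg_pos)
  have N: "0 < N" by (simp add: N_def)
  \<comment> \<open>The bound for \<open>J - L\<close>: the first entry meets the smallness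
    condition of \<open>perturbed_inverse_near\<close>, the second keeps its share of
    \<open>norm (B - K)\<close> below \<open>\<eta> / 8\<close>.\<close>
  define d where "d = min (1 / (2 * \<kappa>)) (\<eta> / (16 * \<kappa>\<^sup>2))"
  have d: "0 < d" "2 * \<kappa> * d \<le> 1" "2 * \<kappa>\<^sup>2 * d \<le> \<eta> / 8"
  proof -
    show "0 < d" using \<kappa> \<open>0 < \<eta>\<close> by (simp add: d_def)
    have "2 * \<kappa> * d \<le> 2 * \<kappa> * (1 / (2 * \<kappa>))"
      using \<kappa> by (intro mult_left_mono) (auto simp: d_def)
    then show "2 * \<kappa> * d \<le> 1" using \<kappa> by simp
    have "2 * \<kappa>\<^sup>2 * d \<le> 2 * \<kappa>\<^sup>2 * (\<eta> / (16 * \<kappa>\<^sup>2))"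
      by (intro mult_left_mono) (auto simp: d_def)
    then show "2 * \<kappa>\<^sup>2 * d \<le> \<eta> / 8" using \<kappa> by simp
  qed
  \<comment> \<open>Each of the parameter, the two factors and \<open>B\<close> may use
    \<open>\<eta> / 4\<close>; the second entry forces the Jacobian to within
    \<open>d\<close>.\<close>
  define \<epsilon> where "\<epsilon> = min (\<eta> / 4) (d / (2 * \<beta> * N))"
  have \<epsilon>: "0 < \<epsilon>" "\<epsilon> \<le> \<eta> / 4" "N * (2 * \<beta> * \<epsilon>) \<le> d"
  proof -
    show "0 < \<epsilon>" "\<epsilon> \<le> \<eta> / 4" using \<open>0 < \<eta>\<close> \<beta> N d by (simp_all add: \<epsilon>_def)
    have "N * (2 * \<beta> * \<epsilon>) \<le> N * (2 * \<beta> * (d / (2 * \<beta> * N)))"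
      using \<beta> N by (intro mult_left_mono) (auto simp: \<epsilon>_def)
    then show "N * (2 * \<beta> * \<epsilon>) \<le> d" using \<beta> N by simp
  qed
  obtain \<delta> where \<delta>: "0 < \<delta>" "\<And>M U s V. norm (M - affine_mat A0 A cs) < \<delta> \<Longrightarrow> is_svd M U s V
    \<Longrightarrow> \<exists>U' V'. is_svd (affine_mat A0 A cs) U' \<sigma> V' \<and> norm (U - U') < \<epsilon> \<and> norm (V - V') < \<epsilon>"
    using svd_near[OF card sv dec pos \<epsilon>(1)] by auto
  obtain r0 where r0: "0 < r0" "\<And>c. c \<noteq> cs \<Longrightarrow> norm (c - cs) < r0
    \<Longrightarrow> norm (affine_mat A0 A c - affine_mat A0 A cs) < \<delta>"
    using tendstoD[OF affine_mat_tendsto \<delta>(1), of A0 A cs] by (auto simp: eventually_at dist_norm)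
  \<comment> \<open>The limit at \<open>cs\<close> excludes the point itself, where the difference
    is zero.\<close>
  have r0': "norm (affine_mat A0 A c - affine_mat A0 A cs) < \<delta>" if "norm (c - cs) < r0" for c
    using r0(2)[of c] that \<delta>(1) by (cases "c = cs") auto
  define r where "r = min r0 (\<eta> / 4)"
  \<comment> \<open>Chosen so that \<open>2 * \<kappa> * (N * \<mu>)\<close> is
    \<open>\<eta> / 8\<close>, the other half of the share of \<open>B\<close>.\<close>
  define \<mu> where "\<mu> = \<eta> / (16 * \<kappa> * N)"
  have "0 < r" "0 < \<mu>" using r0(1) \<open>0 < \<eta>\<close> \<kappa> N by (simp_all add: r_def \<mu>_def)
  moreover have "\<exists>U' V'. is_svd (affine_mat A0 A cs) U' \<sigma> V'
      \<and> cf_error K cs (c, transpose U' ** U, transpose V' ** V, B) \<le> \<eta>"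
    if c: "norm (c - cs) < r" and ini: "cf_init A0 A c U V"
      and B: "spectral_norm (mat 1 - B ** jac_mat A U V) \<le> \<mu>" for c U V B
  proof -
    obtain s where svd: "is_svd (affine_mat A0 A c) U s V"
      using ini by (auto simp: cf_init_def)
    have "norm (c - cs) < r0" using c by (simp add: r_def)
    then obtain U' V' where svd': "is_svd (affine_mat A0 A cs) U' \<sigma> V'"
      and near: "norm (U - U') < \<epsilon>" "norm (V - V') < \<epsilon>"
      using \<delta>(2)[OF r0' svd] by blast
    have orth: "orthogonal_matrix U" "orthogonal_matrix V" "orthogonal_matrix U'" "orthogonal_matrix V'"
      using svd svd' by (simp_all add: is_svd_def)
    have J: "norm (jac_mat A U V - L) \<le> d"
    proof -
      have "norm (jac_mat A U V - jac_mat A U' V') \<le> real CARD('n) * real CARD('n) * (2 * \<beta> * \<epsilon>)"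
        using near by (intro jac_mat_lipschitz orth A_le) simp_all
      then show ?thesis using \<epsilon>(3) by (simp add: jac[OF svd'] N_def)
    qed
    have res: "norm (mat 1 - B ** jac_mat A U V) \<le> N * \<mu>"
      unfolding N_def by (rule norm_matrix_le_entries) (rule order.trans[OF entry_le_spectral_norm B])
    have S: "2 * \<kappa> * norm (mat 1 - B ** jac_mat A U V) \<le> \<eta> / 8"
    proof -
      have "2 * \<kappa> * norm (mat 1 - B ** jac_mat A U V) \<le> 2 * \<kappa> * (N * \<mu>)"
        using \<kappa> res by (intro mult_left_mono) auto
      also have "\<dots> = \<eta> / 8" using \<kappa> N by (simp add: \<mu>_def)
      finally show ?thesis .
    qed
    have "2 * \<kappa> * norm (jac_mat A U V - L) \<le> 2 * \<kappa> * d"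
      using \<kappa> J by (intro mult_left_mono) auto
    then have "norm (B - K) \<le> 2 * \<kappa> * norm (mat 1 - B ** jac_mat A U V) + 2 * \<kappa>\<^sup>2 * norm (jac_mat A U V - L)"
      using d(2) by (intro perturbed_inverse_near[OF K \<kappa>(2)]) simp
    also have "\<dots> \<le> \<eta> / 8 + 2 * \<kappa>\<^sup>2 * d"
      by (intro add_mono S mult_left_mono J) simp
    finally have "norm (B - K) \<le> \<eta> / 4" using d(3) by simp
    moreover have "norm (c - cs) \<le> \<eta> / 4" using c by (simp add: r_def)
    ultimately have "cf_error K cs (c, transpose U' ** U, transpose V' ** V, B) \<le> \<eta>"
      using cf_error_initial[OF orth(1,3,4), of K cs c V B] near \<epsilon>(2) by linarith
    then show ?thesis using svd' by blast
  qed
  ultimately show ?thesis by blast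
qed

lemma cf_error_ge_norm: "norm (fst s - cs) \<le> cf_error K cs s"
  by (simp add: cf_error_def split: prod.split)

lemma cf_error_nonneg: "0 \<le> cf_error K cs s"
  by (rule order.trans[OF norm_ge_zero cf_error_ge_norm])

text \<open>The scaling \<open>C * \<theta>^2 \<le> 1\<close> turns
  \<open>C * (\<theta> * h)^3\<close> into at most \<open>\<theta> * h^3\<close>, and cubing
  \<open>h\<close> triples its exponent. The start \<open>\<theta> / 2\<close> matches
  \<open>3^0 = 1\<close>.\<close>

lemma cubic_decay:
  fixes \<phi> :: "nat \<Rightarrow> real"
  assumes nonneg: "\<And>k. 0 \<le> \<phi> k" and "0 < C" "0 < \<theta>" and C: "C * \<theta>\<^sup>2 \<le> 1" and "\<theta> \<le> 1" and "\<phi> 0 \<le> \<theta> / 2"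
    and step: "\<And>k. \<phi> k \<le> 1 \<Longrightarrow> \<phi> (Suc k) \<le> C * \<phi> k ^ 3"
  shows "\<phi> k \<le> \<theta> * (1/2) ^ (3 ^ k)"
proof (induction k)
  case 0
  show ?case using assms by simp
next
  case (Suc k)
  let ?h = "(1/2::real) ^ (3 ^ k)"
  have "\<theta> * ?h \<le> 1 * 1"
    using \<open>0 < \<theta>\<close> \<open>\<theta> \<le> 1\<close> by (intro mult_mono power_le_one) auto
  then have "\<phi> (Suc k) \<le> C * \<phi> k ^ 3" using Suc.IH by (intro step) simp
  also have "\<dots> \<le> C * (\<theta> * ?h) ^ 3"
    using Suc.IH nonneg \<open>0 < C\<close> by (intro mult_left_mono power_mono) auto
  also have "\<dots> = (C * \<theta>\<^sup>2) * (\<theta> * ?h ^ 3)"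
    by (simp add: power_mult_distrib power2_eq_square power3_eq_cube mult_ac)
  also have "\<dots> \<le> 1 * (\<theta> * ?h ^ 3)"
    using C \<open>0 < \<theta>\<close> by (intro mult_right_mono) auto
  finally show ?case by (simp add: power_mult[symmetric] mult.commute)
qed

theorem theorem3p1:
  fixes A0 :: "('m::{finite,linorder}, 'n::{finite,linorder}) rmat"
    and A :: "'n \<Rightarrow> ('m, 'n) rmat"
    and \<sigma> :: "'n \<Rightarrow> real"
    and cs :: "'n rvec"
    and u :: "'n \<Rightarrow> 'm rvec"
    and v :: "'n \<Rightarrow> 'n rvec"
  assumes "CARD('n) \<le> CARD('m)"
    and "\<And>i j. i < j \<Longrightarrow> \<sigma> j < \<sigma> i"
    and "\<And>i. 0 < \<sigma> i"
    and "singular_values (affine_mat A0 A cs) \<sigma>"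
    and "\<And>i. unit_singular_pair (affine_mat A0 A cs) (\<sigma> i) (u i) (v i)"
    and "invertible (jac A u v)"
  shows "\<exists>r>0. \<exists>\<mu>>0. \<exists>L>0. \<forall>c0. norm (c0 - cs) < r \<longrightarrow>
           cf_well_defined A0 A \<sigma> c0 \<and>
           (\<forall>U0 V0 B0.
              cf_init A0 A c0 U0 V0 \<and> spectral_norm (mat 1 - B0 ** jac_mat A U0 V0) \<le> \<mu> \<longrightarrow>
              cf_seq A0 A \<sigma> c0 U0 V0 B0 \<longlonglongrightarrow> cs \<and>
              root_rate (cf_seq A0 A \<sigma> c0 U0 V0 B0) cs \<ge> 3 \<and>
              (\<forall>k. norm (cf_seq A0 A \<sigma> c0 U0 V0 B0 k - cs) \<le> L * r * (1/2) ^ (3 ^ k)))"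
proof -
  note card = assms(1) and dec = assms(2) and pos = assms(3) and sv = assms(4)
  have sigma_ne: "\<sigma> i \<noteq> \<sigma> j" if "i \<noteq> j" for i j
    using that dec[of i j] dec[of j i] by (cases i j rule: linorder_cases) auto
  have sigma_sq: "(\<sigma> i)\<^sup>2 - (\<sigma> j)\<^sup>2 \<noteq> 0" if "i \<noteq> j" for i j
    using sigma_ne[OF that] pos[of i] pos[of j] by (simp add: power2_eq_iff)
  have sigma_nz: "\<sigma> i \<noteq> 0" for i using pos[of i] by simp
  obtain K where "jac A u v ** K = mat 1" and K: "K ** jac A u v = mat 1"
    using assms(6) by (auto simp: invertible_def)
  have jac: "jac_mat A U V = jac A u v" if "is_svd (affine_mat A0 A cs) U \<sigma> V" for U V
    by (rule jac_singular_pairs_eq[OF card that sigma_ne pos assms(5), symmetric])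
  define \<beta> where "\<beta> = (\<Sum>j\<in>UNIV. norm (A j))"
  have \<beta>: "norm (A j) \<le> \<beta>" for j
    unfolding \<beta>_def by (rule member_le_sum) auto
  obtain C where "0 < C" and C: "\<And>(A0 :: ('m, 'n) rmat) A s. \<forall>j. norm (A j) \<le> \<beta> \<Longrightarrow>
      affine_mat A0 A cs = rect_diag \<sigma> \<Longrightarrow> K ** jac_mat A (mat 1) (mat 1) = mat 1 \<Longrightarrow>
      cf_error K cs s \<le> 1 \<Longrightarrow> cf_error K cs (cf_step A0 A \<sigma> s) \<le> C * cf_error K cs s ^ 3"
    using cf_step_cubic[where \<sigma> = \<sigma> and \<beta> = \<beta> and cs = cs and K = K, OF card sigma_sq sigma_nz] by blast
  \<comment> \<open>The second entry gives \<open>C * \<theta>^2 \<le> 1\<close>; the first keeps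
    all states in the range of the cubic bound.\<close>
  define \<theta> where "\<theta> = min 1 (1 / sqrt C)"
  have \<theta>: "0 < \<theta>" "\<theta> \<le> 1" using \<open>0 < C\<close> by (simp_all add: \<theta>_def)
  have "\<theta>\<^sup>2 \<le> (1 / sqrt C)\<^sup>2"
    using \<theta> by (intro power_mono) (simp_all add: \<theta>_def)
  then have C\<theta>: "C * \<theta>\<^sup>2 \<le> 1"
    using \<open>0 < C\<close> by (simp add: power_divide field_simps)
  obtain r \<mu> where "0 < r" "0 < \<mu>" and init: "\<And>c U V B. norm (c - cs) < r \<Longrightarrow> cf_init A0 A c U V
      \<Longrightarrow> spectral_norm (mat 1 - B ** jac_mat A U V) \<le> \<mu>
      \<Longrightarrow> \<exists>U' V'. is_svd (affine_mat A0 A cs) U' \<sigma> V'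
        \<and> cf_error K cs (c, transpose U' ** U, transpose V' ** V, B) \<le> \<theta> / 2"
    using initial_error_small[OF card dec pos sv jac K, of "\<theta> / 2"] \<theta>(1) by auto
  have well: "cf_well_defined A0 A \<sigma> c" for c
    using svd_exists[OF card, of "affine_mat A0 A c"] sigma_sq sigma_nz
    by (auto simp: cf_well_defined_def cf_init_def)
  have decay: "norm (cf_seq A0 A \<sigma> c U V B k - cs) \<le> \<theta> * (1/2) ^ (3 ^ k)"
    if start: "norm (c - cs) < r" "cf_init A0 A c U V" "spectral_norm (mat 1 - B ** jac_mat A U V) \<le> \<mu>"
    for c U V B k
  proof -
    obtain P Q where svd: "is_svd (affine_mat A0 A cs) P \<sigma> Q"
      and err: "cf_error K cs (c, transpose P ** U, transpose Q ** V, B) \<le> \<theta> / 2"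
      using init[OF start] by blast
    let ?M = "transpose P ** A0 ** Q" and ?N = "\<lambda>j. transpose P ** A j ** Q"
    let ?s = "\<lambda>k. (cf_step ?M ?N \<sigma> ^^ k) (c, transpose P ** U, transpose Q ** V, B)"
    have P: "orthogonal_matrix P" and Q: "orthogonal_matrix Q"
      using svd by (simp_all add: is_svd_def)
    have "norm (?N j) \<le> \<beta>" for j
      using \<beta>[of j] P Q by (simp add: norm_orthogonal_mult_left norm_orthogonal_mult_right)
    moreover have "affine_mat ?M ?N cs = rect_diag \<sigma>"
      using svd by (simp add: affine_mat_sandwich is_svd_def rect_diag_def)
    \<comment> \<open>The Jacobian of the rotated problem at the identity is the original one at
      \<open>P\<close>, \<open>Q\<close>, hence does not depend on the decomposition; one
      \<open>K\<close> serves all starts.\<close>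
    moreover have "K ** jac_mat ?N (mat 1) (mat 1) = mat 1"
      using jac_mat_mult[of A P "mat 1" Q "mat 1"] jac[OF svd] K by simp
    ultimately have "cf_error K cs (?s k) \<le> \<theta> * (1/2) ^ (3 ^ k)"
      using err by (intro cubic_decay[OF cf_error_nonneg \<open>0 < C\<close> \<theta>(1) C\<theta> \<theta>(2)]) (simp_all add: C)
    moreover have "rotate_state P Q (c, transpose P ** U, transpose Q ** V, B) = (c, U, V, B)"
      using P Q by (simp add: rotate_state_def matrix_mul_assoc orthogonal_matrix_def)
    then have "cf_seq A0 A \<sigma> c U V B k = fst (?s k)"
      using cf_step_funpow_rotate_state[OF P Q, of k A0 A \<sigma> "(c, transpose P ** U, transpose Q ** V, B)"]
      by (simp add: cf_seq_def)
    ultimately show ?thesis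
      using cf_error_ge_norm[of "?s k" cs K] by simp
  qed
  have "strict_mono (\<lambda>k. 3 ^ k :: nat)" by (rule strict_monoI) simp
  from LIMSEQ_subseq_LIMSEQ[OF LIMSEQ_power_zero this, of "1/2 :: real"]
  have lim: "(\<lambda>k. \<theta> * (1/2::real) ^ (3 ^ k)) \<longlonglongrightarrow> 0"
    by (intro tendsto_mult_right_zero) (simp add: o_def)
  \<comment> \<open>With \<open>L = \<theta> / r\<close> the factor \<open>L * r\<close> is the
    constant \<open>\<theta>\<close> of the decay estimate.\<close>
  show ?thesis
  proof (rule exI[of _ r], rule conjI, fact, rule exI[of _ \<mu>], rule conjI, fact,
      rule exI[of _ "\<theta> / r"], intro conjI allI impI; (elim conjE)?)
    fix c U V B
    assume start: "norm (c - cs) < r" "cf_init A0 A c U V"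
      "spectral_norm (mat 1 - B ** jac_mat A U V) \<le> \<mu>"
    note d = decay[OF start]
    show "cf_seq A0 A \<sigma> c U V B \<longlonglongrightarrow> cs"
      by (rule LIM_zero_cancel) (rule Lim_null_comparison[OF always_eventually[OF allI[OF d]] lim])
    show "3 \<le> root_rate (cf_seq A0 A \<sigma> c U V B) cs"
      by (rule root_rate_ge_3[OF d])
    show "norm (cf_seq A0 A \<sigma> c U V B k - cs) \<le> \<theta> / r * r * (1/2) ^ (3 ^ k)" for k
      using d[of k] \<open>0 < r\<close> by simp
  qed (use \<open>0 < r\<close> \<theta>(1) well in simp_all)
qed

end
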